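(* Let $R$ be a commutative discrete valuation domain with maximal ideal $(p)$, and let $\Sigma\text{-cyc}(R)$ denote the class of $R$-modules that are direct sums of cyclic torsion $R$-modules (i.e. of modules $R/(p^n)$, $n\ge1$). For $n\ge1$ define the pickets $P^n_0=(R/(p^n),0)$, $P^n_1=(R/(p^n),(p^{n-1})/(p^n))$, $P^n_{n-1}=(R/(p^n),(p)/(p^n))$, $P^n_n=(R/(p^n),R/(p^n))$. Then: (1) If $M\in\Sigma\text{-cyc}(R)$ and $U\subseteq M$ is a submodule with $p(M/U)=0$, then $(M,U)$ is isomorphic to a direct sum of pickets of type $P^n_n$ or $P^n_{n-1}$. (2) If $M\in\Sigma\text{-cyc}(R)$ and $U\subseteq M$ is a submodule with $pU=0$, then $(M,U)$ is isomorphic to a direct sum of pickets of type $P^n_0$ or $P^n_1$ if and only if $M/U\in\Sigma\text{-cyc}(R)$. (3) Every decomposition of such a pair as a direct sum of pickets is unique up to reordering and isomorphism of the summands.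
   Context: A pair $(M,U)$ consists of an $R$-module $M$ and a submodule $U$. A morphism of pairs $(M,U)\to(M',U')$ is an $R$-linear map $f:M\to M'$ with $f(U)\subseteq U'$; isomorphisms are the invertible such morphisms. Direct sums of pairs are taken componentwise: $\bigoplus_i(M_i,U_i)=(\bigoplus_iM_i,\bigoplus_iU_i)$. *)

theory Defs
  imports Complex_Main
begin

definition is_ideal :: "'r::comm_ring_1 set \<Rightarrow> bool" where
  "is_ideal I \<longleftrightarrow> 0 \<in> I \<and> (\<forall>a\<in>I. \<forall>b\<in>I. a + b \<in> I) \<and> (\<forall>a\<in>I. \<forall>r. r * a \<in> I)"

text \<open>R (a commutative domain) is a discrete valuation domain with maximal ideal (p):
  R is a principal ideal domain, p is a nonzero non-unit, and the non-units are exactly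
  the multiples of p, i.e. (p) is the unique maximal ideal (R local, not a field).\<close>
definition dvr_with_uniformizer :: "'r::idom \<Rightarrow> bool" where
  "dvr_with_uniformizer p \<longleftrightarrow>
     p \<noteq> 0 \<and> \<not> p dvd 1 \<and>
     (\<forall>I::'r set. is_ideal I \<longrightarrow> (\<exists>a. I = {a * r | r. True})) \<and>
     (\<forall>x. \<not> x dvd 1 \<longrightarrow> p dvd x)"

text \<open>For a module over R on the type 'm (scalar multiplication scale) and a submodule U,
  the quotient M/U is in Sigma-cyc(R): it is the (internal) direct sum of cyclic submodules
  R(x+U), x in X, each isomorphic to R/(p^(n x)) with n x >= 1 (i.e. with annihilator (p^(n x))).
  Taking U = {0} expresses M itself is in Sigma-cyc(R).\<close>
definition sigma_cyc_quot :: "('r::comm_ring_1 \<Rightarrow> 'm::ab_group_add \<Rightarrow> 'm) \<Rightarrow> 'r \<Rightarrow> 'm set \<Rightarrow> bool" where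
  "sigma_cyc_quot scale p U \<longleftrightarrow>
     (\<exists>(X::'m set) (n::'m \<Rightarrow> nat).
        (\<forall>x\<in>X. 1 \<le> n x \<and> {r. scale r x \<in> U} = {r. p ^ n x dvd r}) \<and>
        (\<forall>m. \<exists>F r. finite F \<and> F \<subseteq> X \<and> m - (\<Sum>x\<in>F. scale (r x) x) \<in> U) \<and>
        (\<forall>F r. finite F \<and> F \<subseteq> X \<and> (\<Sum>x\<in>F. scale (r x) x) \<in> U
               \<longrightarrow> (\<forall>x\<in>F. scale (r x) x \<in> U)))"

abbreviation sigma_cyc :: "('r::comm_ring_1 \<Rightarrow> 'm::ab_group_add \<Rightarrow> 'm) \<Rightarrow> 'r \<Rightarrow> bool" where
  "sigma_cyc scale p \<equiv> sigma_cyc_quot scale p {0}"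

text \<open>The picket P^n_k = (R/(p^n), (p^(n-k))/(p^n)) for 0 <= k <= n, n >= 1.
  In particular P^n_0 = (R/(p^n),0), P^n_1 = (R/(p^n),(p^(n-1))/(p^n)),
  P^n_(n-1) = (R/(p^n),(p)/(p^n)), P^n_n = (R/(p^n),R/(p^n)).
  picket_decomp scale p U X n k says that the pair (M,U) (M the whole module on 'm)
  is the (internal) direct sum of the pairs (Rx, p^(n x - k x) R x), x in X, where
  Rx is isomorphic to R/(p^(n x)); so (Rx, U \<inter> Rx) is isomorphic to the picket P^(n x)_(k x),
  and (M,U) is isomorphic to the direct sum of the pickets P^(n x)_(k x), x in X.\<close>
definition picket_decomp ::
  "('r::comm_ring_1 \<Rightarrow> 'm::ab_group_add \<Rightarrow> 'm) \<Rightarrow> 'r \<Rightarrow> 'm set \<Rightarrow> 'm set \<Rightarrow> ('m \<Rightarrow> nat) \<Rightarrow> ('m \<Rightarrow> nat) \<Rightarrow> bool" where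
  "picket_decomp scale p U X n k \<longleftrightarrow>
     (\<forall>x\<in>X. 1 \<le> n x \<and> k x \<le> n x \<and> {r. scale r x = 0} = {r. p ^ n x dvd r}) \<and>
     (\<forall>m. \<exists>F r. finite F \<and> F \<subseteq> X \<and> m = (\<Sum>x\<in>F. scale (r x) x)) \<and>
     (\<forall>F r. finite F \<and> F \<subseteq> X \<and> (\<Sum>x\<in>F. scale (r x) x) = 0
            \<longrightarrow> (\<forall>x\<in>F. scale (r x) x = 0)) \<and>
     U = {(\<Sum>x\<in>F. scale (p ^ (n x - k x) * r x) x) | F r. finite F \<and> F \<subseteq> X}"

end

theory Submission
  imports Defs
begin

text \<open>Write S for the socle of M, the kernel of multiplication by p. If Z is a basis of S such that every
combination of elements of Z lying in p^e M involves only elements of Z of height at least e, then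
dividing each z in Z by p as often as possible gives generators of a decomposition of M into cyclic
modules. Picket decompositions therefore come from bases of S adapted to a finer filtration.
In (1) the filtration is M, U, pM, pU, ... intersected with S. In (2) the basis is pieced together from
an adapted basis of U and lifts of an adapted basis of S/U, where S/U sits in the socle of M/U.
Adapted bases exist, by Kulikov's argument, as soon as the space is a union of an ascending chain of
subspaces E j that meet the j-th filtration step trivially. A decomposition of M or M/U into cyclic
modules supplies the chain: E j is generated by the summands of exponent at most j.

For (3), the pickets of type (a, b) in any decomposition form a basis over R/(p) of a subquotient that is
defined without the decomposition: the elements y with p^a y = 0 and p^(a-b) y in U, modulo pM and the
two submodules obtained by lowering one of the exponents a and a-b by 1.\<close>

locale dvr_module = module scale
  for scale :: "'r::idom \<Rightarrow> 'm::ab_group_add \<Rightarrow> 'm" (infixr "*s" 75) +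
  fixes p :: 'r
  assumes dvr: "dvr_with_uniformizer p"
begin

section \<open>Arithmetic of powers of \<open>p\<close>, and coordinates in spans\<close>

lemma p_nonzero: "p \<noteq> 0"
  using dvr by (simp add: dvr_with_uniformizer_def)

lemma p_not_dvd_1: "\<not> p dvd 1"
  using dvr by (simp add: dvr_with_uniformizer_def)

text \<open>Locality of R enters here. Inverting coefficients prime to \<open>p\<close> inside R
  replaces division in the residue field, so that no quotient field has to be constructed.\<close>

lemma unitE:
  assumes "\<not> p dvd c"
  obtains d where "d * c = 1"
  using dvr assms unfolding dvr_with_uniformizer_def by (metis dvdE mult.commute)

lemma pow_dvd_cancel: "p ^ (a + b) dvd p ^ a * r \<longleftrightarrow> p ^ b dvd r"
  using p_nonzero by (simp add: power_add)

lemma pow_dvd_cancel_le: "a \<le> n \<Longrightarrow> p ^ n dvd p ^ a * r \<longleftrightarrow> p ^ (n - a) dvd r"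
  using pow_dvd_cancel[of a "n - a" r] by simp

lemma pow_not_dvd_1: "1 \<le> n \<Longrightarrow> \<not> p ^ n dvd 1"
  using p_not_dvd_1 le_imp_power_dvd[of 1 n p] dvd_trans[of p "p ^ n" 1] by auto

text \<open>Prescribing a finite part \<open>G\<close> of the support lets two expansions be
  compared over one index set. Indexing by \<open>Z\<close> instead of its image spares an
  injectivity assumption on \<open>g\<close>.\<close>

lemma span_coords:
  assumes "v \<in> span (g ` Z)" "finite G" "G \<subseteq> Z"
  obtains F c where "finite F" "G \<subseteq> F" "F \<subseteq> Z" "v = (\<Sum>z\<in>F. c z *s g z)"
proof -
  have "\<exists>F c. finite F \<and> G \<subseteq> F \<and> F \<subseteq> Z \<and> v = (\<Sum>z\<in>F. c z *s g z)"
    using assms(1)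
  proof (induction rule: span_induct_alt)
    case base
    then show ?case
      using assms(2,3) by (intro exI[of _ G] exI[of _ "\<lambda>_. 0"]) auto
  next
    case (step c x y)
    then obtain z F d where z: "z \<in> Z" "x = g z"
      and F: "finite F" "G \<subseteq> F" "F \<subseteq> Z" "y = (\<Sum>z\<in>F. d z *s g z)" by blast
    \<comment> \<open>The new index \<open>z\<close> may already lie in \<open>F\<close>, so its
      coefficient is added to the old one; values of \<open>d\<close> outside \<open>F\<close> are
      arbitrary and must be cut off.\<close>
    let ?d = "\<lambda>w. (if w = z then c else 0) + (if w \<in> F then d w else 0)"
    have "(\<Sum>w\<in>insert z F. ?d w *s g w) =
        (\<Sum>w\<in>insert z F. (if w = z then c else 0) *s g w) + (\<Sum>w\<in>insert z F. (if w \<in> F then d w else 0) *s g w)"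
      by (simp add: scale_left_distrib sum.distrib del: sum.insert)
    also have "(\<Sum>w\<in>insert z F. (if w = z then c else 0) *s g w) = (\<Sum>w\<in>{z}. c *s g w)"
      using F(1) by (intro sum.mono_neutral_cong_right) auto
    also have "(\<Sum>w\<in>insert z F. (if w \<in> F then d w else 0) *s g w) = y"
      unfolding F(4) using F(1) by (intro sum.mono_neutral_cong_right) auto
    finally have "c *s x + y = (\<Sum>w\<in>insert z F. ?d w *s g w)" using z by simp
    then show ?case
      using F z by (intro exI[of _ "insert z F"] exI[of _ ?d]) auto
  qed
  then show ?thesis using that by blast
qed

lemma span_mod_coords:
  assumes "v \<in> span (g ` Z \<union> B)" "subspace B" "finite G" "G \<subseteq> Z"
  obtains F c b where "finite F" "G \<subseteq> F" "F \<subseteq> Z" "b \<in> B" "v = (\<Sum>z\<in>F. c z *s g z) + b"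
proof -
  obtain w b where "w \<in> span (g ` Z)" "b \<in> B" "v = w + b"
    using assms(1,2) span_minimal[OF subset_refl assms(2)] unfolding span_Un by auto
  then show ?thesis using that span_coords[OF _ assms(3,4)] by metis
qed

lemma sum_extend:
  assumes "finite F" "G \<subseteq> F"
  shows "(\<Sum>z\<in>G. c z *s g z) = (\<Sum>z\<in>F. (if z \<in> G then c z else 0) *s g z)"
  using assms by (intro sum.mono_neutral_cong_left) auto

subsection \<open>Bases of subquotients over the residue field\<close>

text \<open>When p Z is contained in B, this is linear independence in M/B over the residue field R/(p).\<close>
definition p_indep :: "'m set \<Rightarrow> 'm set \<Rightarrow> bool" where
  "p_indep Z B \<longleftrightarrow> (\<forall>F c. finite F \<and> F \<subseteq> Z \<and> (\<Sum>z\<in>F. c z *s z) \<in> B \<longrightarrow> (\<forall>z\<in>F. p dvd c z))"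

lemma p_indepD: "p_indep Z B \<Longrightarrow> finite F \<Longrightarrow> F \<subseteq> Z \<Longrightarrow> (\<Sum>z\<in>F. c z *s z) \<in> B \<Longrightarrow> z \<in> F \<Longrightarrow> p dvd c z"
  unfolding p_indep_def by blast

text \<open>In a relation modulo \<open>B\<close> the coefficient of \<open>v\<close> cannot be a
  unit, since dividing by it would put \<open>v\<close> into the span. So \<open>p\<close> divides
  it, its term lies in \<open>B\<close>, and a relation among elements of \<open>Z\<close>
  remains.\<close>

lemma p_indep_insert:
  assumes B: "subspace B" and Z: "p_indep Z B" and v: "p *s v \<in> B" "v \<notin> span (Z \<union> B)"
  shows "p_indep (insert v Z) B"
  unfolding p_indep_def
proof (intro allI impI, elim conjE)
  fix F c assume F: "finite F" "F \<subseteq> insert v Z" "(\<Sum>z\<in>F. c z *s z) \<in> B"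
  let ?F = "F - {v}"
  have rest: "(\<Sum>z\<in>?F. c z *s z) \<in> span (Z \<union> B)"
    using F(2) by (intro span_sum span_scale span_base) auto
  show "\<forall>z\<in>F. p dvd c z"
  proof (cases "v \<in> F")
    case False
    then show ?thesis using Z F unfolding p_indep_def by blast
  next
    case True
    have sum: "(\<Sum>z\<in>F. c z *s z) = c v *s v + (\<Sum>z\<in>?F. c z *s z)"
      using F(1) True by (simp add: sum.remove)
    have pv: "p dvd c v"
    proof (rule ccontr)
      assume "\<not> p dvd c v"
      then obtain d where d: "d * c v = 1" by (rule unitE)
      have "c v *s v = (\<Sum>z\<in>F. c z *s z) - (\<Sum>z\<in>?F. c z *s z)"
        using sum by simp
      also have "\<dots> \<in> span (Z \<union> B)"
        using F(3) rest by (intro span_diff) (auto intro: span_base)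
      finally have "d *s c v *s v \<in> span (Z \<union> B)" by (rule span_scale)
      then show False using d v by simp
    qed
    then obtain e where "c v = e * p" by (metis dvdE mult.commute)
    then have "c v *s v \<in> B"
      using subspace_scale[OF B v(1), of e] by simp
    then have "(\<Sum>z\<in>?F. c z *s z) \<in> B"
      using subspace_diff[OF B F(3)] sum by (metis add_diff_cancel_left')
    then have "\<forall>z\<in>?F. p dvd c z"
      using p_indepD[OF Z, of ?F c] F(1,2) by blast
    then show ?thesis using pv by blast
  qed
qed

text \<open>Zorn's lemma gives a maximal independent subset of \<open>V\<close>. It spans, because
  by \<open>p_indep_insert\<close> any vector outside the span could be adjoined.\<close>

lemma p_basis_exists:
  assumes "subspace B" and pV: "\<And>v. v \<in> V \<Longrightarrow> p *s v \<in> B"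
  obtains Z where "Z \<subseteq> V" "p_indep Z B" "V \<subseteq> span (Z \<union> B)"
proof -
  let ?A = "{Z. Z \<subseteq> V \<and> p_indep Z B}"
  have "\<exists>Z\<in>?A. \<forall>X\<in>?A. Z \<subseteq> X \<longrightarrow> X = Z"
  proof (rule subset_Zorn_nonempty)
    have "{} \<in> ?A" unfolding p_indep_def by auto
    then show "?A \<noteq> {}" by blast
    fix C assume C: "C \<noteq> {}" "subset.chain ?A C"
    have "p_indep (\<Union>C) B"
      unfolding p_indep_def
    proof (intro allI impI, elim conjE)
      fix F c assume F: "finite F" "F \<subseteq> \<Union>C" "(\<Sum>z\<in>F. c z *s z) \<in> B"
      obtain Z where "Z \<in> C" "F \<subseteq> Z"
        using finite_subset_Union_chain[OF F(1,2) C] by blast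
      moreover then have "p_indep Z B" using C(2) unfolding subset.chain_def by blast
      ultimately show "\<forall>z\<in>F. p dvd c z" using F unfolding p_indep_def by blast
    qed
    moreover have "\<Union>C \<subseteq> V" using C(2) unfolding subset.chain_def by blast
    ultimately show "\<Union>C \<in> ?A" by blast
  qed
  then obtain Z where Z0: "Z \<in> ?A" and max: "\<forall>X\<in>?A. Z \<subseteq> X \<longrightarrow> X = Z" by (rule bexE)
  have Z: "Z \<subseteq> V" "p_indep Z B" using Z0 by auto
  have "v \<in> span (Z \<union> B)" if "v \<in> V" for v
  proof (rule ccontr)
    assume n: "v \<notin> span (Z \<union> B)"
    then have "p_indep (insert v Z) B"
      using p_indep_insert assms(1) Z(2) pV[OF that] by blast
    then have "insert v Z \<in> ?A" using Z(1) that by blast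
    then have "insert v Z = Z" using max by blast
    then show False using n by (metis UnI1 insertI1 span_base)
  qed
  then show ?thesis using that Z by blast
qed

text \<open>Steinitz exchange by induction on \<open>S\<close>. The submodule \<open>B\<close>
  varies in the induction because it absorbs the exchanged elements.\<close>

lemma p_indep_card_le:
  assumes "finite S" "finite I" "subspace B" "p_indep I B" "I \<subseteq> span (S \<union> B)"
    and "\<And>s. s \<in> S \<Longrightarrow> p *s s \<in> B"
  shows "card I \<le> card S"
  using assms
proof (induction S arbitrary: B I rule: finite_induct)
  case empty
  have "I = {}"
  proof (rule ccontr)
    assume "I \<noteq> {}"
    then obtain x where x: "x \<in> I" by blast
    then have "(\<Sum>z\<in>{x}. 1 *s z) \<in> B" using empty.prems(2,4) span_minimal[OF subset_refl empty.prems(2)] by auto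
    then show False
      using p_indepD[OF empty.prems(3), of "{x}" "\<lambda>_. 1" x] x p_not_dvd_1 by auto
  qed
  then show ?case by simp
next
  case (insert s S B I)
  show ?case
  proof (cases "I \<subseteq> span (S \<union> B)")
    case True
    then have "card I \<le> card S"
      using insert.IH[OF insert.prems(1-3)] insert.prems(5) by blast
    then show ?thesis using insert.hyps by simp
  next
    case False
    then obtain a where a: "a \<in> I" "a \<notin> span (S \<union> B)" by blast
    \<comment> \<open>Exchange a for s and work modulo a.\<close>
    let ?B = "span (insert a B)"
    have "a \<in> span (insert s (S \<union> B))" using a(1) insert.prems(4) by auto
    then obtain k where k: "a - k *s s \<in> span (S \<union> B)"
      unfolding span_insert by blast
    \<comment> \<open>If \<open>p\<close> divided \<open>k\<close>, the term in \<open>s\<close>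
      would fall into \<open>B\<close> and \<open>a\<close> would already lie in the smaller span.
      So \<open>k\<close> is a unit and \<open>s\<close> can be expressed through
      \<open>a\<close>.\<close>
    have "\<not> p dvd k"
    proof
      assume "p dvd k"
      then obtain e where "k = e * p" by (metis dvdE mult.commute)
      then have "k *s s \<in> B"
        using subspace_scale[OF insert.prems(2) insert.prems(5)[of s], of e] by simp
      then show False using k a(2) by (metis UnCI diff_add_cancel span_add span_base)
    qed
    then obtain d where d: "d * k = 1" by (rule unitE)
    have "a - k *s s \<in> span (insert a (S \<union> B))" using k span_mono[of "S \<union> B" "insert a (S \<union> B)"] by blast
    then have "k *s s \<in> span (insert a (S \<union> B))"
      using span_diff[OF span_base[of a "insert a (S \<union> B)"], of "a - k *s s"] by simp
    then have "d *s k *s s \<in> span (insert a (S \<union> B))" by (rule span_scale)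
    then have s: "s \<in> span (insert a (S \<union> B))" using d by simp
    have "span (insert s S \<union> B) \<subseteq> span (insert a (S \<union> B))"
      using s by (intro span_minimal) (auto intro: span_base)
    also have "\<dots> \<subseteq> span (S \<union> ?B)"
      by (intro span_minimal) (auto intro: span_base)
    finally have sub: "I \<subseteq> span (S \<union> ?B)" using insert.prems(4) by blast
    have "p_indep (I - {a}) ?B"
      unfolding p_indep_def
    proof (intro allI impI, elim conjE)
      fix F c assume F: "finite F" "F \<subseteq> I - {a}" "(\<Sum>z\<in>F. c z *s z) \<in> ?B"
      then obtain k where k: "(\<Sum>z\<in>F. c z *s z) - k *s a \<in> B"
        using span_minimal[OF subset_refl insert.prems(2)] unfolding span_insert by auto
      \<comment> \<open>Giving \<open>a\<close> the coefficient \<open>- k\<close> turns a relation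
        modulo the enlarged \<open>?B\<close> into one modulo \<open>B\<close>.\<close>
      let ?c = "c(a := - k)"
      have aF: "a \<notin> F" using F by auto
      have "(\<Sum>z\<in>insert a F. ?c z *s z) = - k *s a + (\<Sum>z\<in>F. ?c z *s z)"
        using F(1) aF by simp
      also have "(\<Sum>z\<in>F. ?c z *s z) = (\<Sum>z\<in>F. c z *s z)"
        using aF by (intro sum.cong) auto
      finally have "(\<Sum>z\<in>insert a F. ?c z *s z) \<in> B" using k by simp
      then have "\<forall>z\<in>insert a F. p dvd ?c z"
        using p_indepD[OF insert.prems(3), of "insert a F" ?c] F a(1) by blast
      then show "\<forall>z\<in>F. p dvd c z" using aF by (metis fun_upd_other insertCI)
    qed
    then have "card (I - {a}) \<le> card S"
      using sub insert.prems(1,5) by (intro insert.IH[of "I - {a}" ?B]) (auto intro: span_base)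
    then show ?thesis
      using a(1) insert.prems(1) insert.hyps by (simp add: card_Diff_singleton)
  qed
qed

text \<open>Each \<open>s\<close> needs only finitely many elements of \<open>I\<close>. The union
  of these supports spans modulo \<open>B\<close>, and an element of \<open>I\<close> outside it
  would depend on other elements of \<open>I\<close>. This feeds the cardinality count for infinite
  bases.\<close>

lemma p_basis_subset_UN:
  assumes "subspace B" "p_indep I B" "I \<subseteq> span (S \<union> B)"
    and "\<And>s. s \<in> S \<Longrightarrow> s \<in> span (I \<union> B)"
  obtains G where "\<And>s. s \<in> S \<Longrightarrow> finite (G s)" "I \<subseteq> (\<Union>s\<in>S. G s)"
proof -
  have "\<exists>F. finite F \<and> F \<subseteq> I \<and> s \<in> span (F \<union> B)" if s: "s \<in> S" for s
  proof -
    have "s \<in> span ((\<lambda>x. x) ` I \<union> B)" using assms(4)[OF s] by simp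
    then obtain F c b where F: "finite F" "F \<subseteq> I" "b \<in> B" "s = (\<Sum>z\<in>F. c z *s z) + b"
      by (rule span_mod_coords[OF _ assms(1), of _ _ _ "{}"]) auto
    then have "s \<in> span (F \<union> B)"
      by (auto intro!: span_add span_sum span_scale intro: span_base)
    then show ?thesis using F by blast
  qed
  then obtain G where G: "\<And>s. s \<in> S \<Longrightarrow> finite (G s) \<and> G s \<subseteq> I \<and> s \<in> span (G s \<union> B)" by metis
  let ?J = "\<Union>s\<in>S. G s"
  have "S \<subseteq> span (?J \<union> B)"
    using G span_mono[of "G _ \<union> B" "?J \<union> B"] by blast
  then have "span (S \<union> B) \<subseteq> span (?J \<union> B)"
    by (intro span_minimal) (auto intro: span_base)
  then have I: "I \<subseteq> span (?J \<union> B)" using assms(3) by blast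
  have "x \<in> ?J" if x: "x \<in> I" for x
  proof (rule ccontr)
    assume n: "x \<notin> ?J"
    have "x \<in> span ((\<lambda>x. x) ` ?J \<union> B)" using I x by auto
    then obtain F c b where F: "finite F" "F \<subseteq> ?J" "b \<in> B" "x = (\<Sum>z\<in>F. c z *s z) + b"
      by (rule span_mod_coords[OF _ assms(1), of _ _ _ "{}"]) auto
    have FI: "F \<subseteq> I" using F(2) G by blast
    have xF: "x \<notin> F" using n F(2) by blast
    \<comment> \<open>Moving \<open>x\<close> to the other side gives a relation whose coefficient
      at \<open>x\<close> is a unit.\<close>
    let ?c = "c(x := - 1)"
    have "(\<Sum>z\<in>insert x F. ?c z *s z) = - 1 *s x + (\<Sum>z\<in>F. ?c z *s z)"
      using F(1) xF by simp
    also have "(\<Sum>z\<in>F. ?c z *s z) = (\<Sum>z\<in>F. c z *s z)"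
      using xF by (intro sum.cong) auto
    also have "- 1 *s x + \<dots> = - b" using F(4) by (simp add: algebra_simps)
    finally have "(\<Sum>z\<in>insert x F. ?c z *s z) \<in> B" using F(3) assms(1) by (simp add: subspace_neg)
    then have "p dvd ?c x"
      using p_indepD[OF assms(2), of "insert x F" ?c] F(1) FI x by blast
    then show False using p_not_dvd_1 by simp
  qed
  then show ?thesis using that[of G] G by blast
qed

text \<open>Invariance of dimension over R/(p). Finite bases are compared by exchange; an infinite
  one is compared with the other through a union of finite sets indexed by it.\<close>

lemma p_bases_equipollent:
  assumes B: "subspace B" and I: "p_indep I B" "I \<subseteq> span (J \<union> B)"
    and J: "p_indep J B" "J \<subseteq> span (I \<union> B)"
    and p: "\<And>x. x \<in> I \<union> J \<Longrightarrow> p *s x \<in> B"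
  shows "\<exists>f. bij_betw f I J"
proof -
  obtain G where G: "\<And>s. s \<in> J \<Longrightarrow> finite (G s)" "I \<subseteq> (\<Union>s\<in>J. G s)"
    using p_basis_subset_UN[OF B I] J(2) by blast
  obtain H where H: "\<And>s. s \<in> I \<Longrightarrow> finite (H s)" "J \<subseteq> (\<Union>s\<in>I. H s)"
    using p_basis_subset_UN[OF B J] I(2) by blast
  have le: "(card_of I, card_of J) \<in> ordLeq" if inf: "infinite J" and G: "\<And>s. s \<in> J \<Longrightarrow> finite (G s)" "I \<subseteq> (\<Union>s\<in>J. G s)"
    for I J :: "'m set" and G :: "'m \<Rightarrow> 'm set"
  proof -
    have "(card_of (G s), card_of J) \<in> ordLeq" if "s \<in> J" for s
      using inf G(1)[OF that] ordLeq_total[OF card_of_Well_order card_of_Well_order]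
        card_of_ordLeq_finite by blast
    then have "(card_of (\<Union>s\<in>J. G s), card_of J) \<in> ordLeq"
      using inf by (intro card_of_UNION_ordLeq_infinite) (auto intro: card_of_mono1)
    then show ?thesis using card_of_mono1[OF G(2)] ordLeq_transitive by blast
  qed
  show ?thesis
  proof (cases "finite J")
    case True
    then have finI: "finite I" using G by (meson finite_UN finite_subset)
    have "card I \<le> card J"
      using p_indep_card_le[OF True finI B I] p by blast
    moreover have "card J \<le> card I"
      using p_indep_card_le[OF finI True B J] p by blast
    ultimately show ?thesis using finite_same_card_bij[OF finI True] by simp
  next
    case False
    then have "infinite I" using H by (meson finite_UN finite_subset)
    then have "(card_of J, card_of I) \<in> ordLeq" using le H by blast
    moreover have "(card_of I, card_of J) \<in> ordLeq" using le False G by blast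
    ultimately have "(card_of I, card_of J) \<in> ordIso" using ordIso_iff_ordLeq by blast
    then show ?thesis using card_of_ordIso by blast
  qed
qed

subsection \<open>Adapted bases\<close>

lemma subspace_pow_image: "subspace V \<Longrightarrow> subspace ((*s) a ` V)"
  by (rule module_hom.subspace_image[OF module_hom_scale_self])

lemma subspace_summand:
  assumes "subspace S" "v = x + y" "v \<in> S" "y \<in> S"
  shows "x \<in> S"
  using subspace_diff[OF assms(1,3,4)] assms(2) by simp

lemma dvd_scale_mem:
  assumes "subspace B" "p *s z \<in> B" "p dvd c"
  shows "c *s z \<in> B"
proof -
  obtain e where "c = e * p" using assms(3) by (metis dvdE mult.commute)
  then show ?thesis using subspace_scale[OF assms(1,2), of e] by simp
qed

text \<open>The base \<open>B\<close> is {0} when a basis of the socle or of \<open>U\<close> is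
  wanted, and \<open>U\<close> when a basis of the socle modulo \<open>U\<close> is wanted. The last
  conclusion is adaptedness: modulo \<open>p\<close>, a combination in \<open>Q a\<close> +
  \<open>B\<close> involves only elements with index at least \<open>a\<close>.\<close>

lemma filtered_p_basis:
  fixes Q E :: "nat \<Rightarrow> 'm set"
  assumes sub: "subspace W" "subspace B" "\<And>a. subspace (Q a)" "\<And>j. subspace (E j)"
    and BW: "B \<subseteq> W" and BE: "\<And>j. B \<subseteq> E j"
    and pW: "\<And>w. w \<in> W \<Longrightarrow> p *s w \<in> B"
    and Q: "decseq Q" "W \<subseteq> Q 0" and E: "incseq E" "W \<subseteq> (\<Union>j. E j)"
    and QE: "\<And>j. W \<inter> Q j \<inter> E j \<subseteq> B"
  obtains Z i where "Z \<subseteq> W" "\<And>z. z \<in> Z \<Longrightarrow> z \<in> Q (i z)" "W \<subseteq> span (Z \<union> B)"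
    and "\<And>F c a z. finite F \<Longrightarrow> F \<subseteq> Z \<Longrightarrow> (\<Sum>z\<in>F. c z *s z) \<in> span (Q a \<union> B) \<Longrightarrow>
      z \<in> F \<Longrightarrow> i z < a \<Longrightarrow> p dvd c z"
proof -
  \<comment> \<open>Kulikov's argument: Q descends and E ascends, and lifted bases of the graded pieces
    D a j / (D (a + 1) j + D a (j - 1) + B) together form an adapted basis. Both neighbours have a smaller
    j - a, and D a j lies in B once a is at least j, which gives spanning by induction.\<close>
  define D where "D a j = W \<inter> Q a \<inter> E j" for a j
  \<comment> \<open>At \<open>j = 0\<close> the lower neighbour is omitted: truncated subtraction
    would make it \<open>D a 0\<close> itself.\<close>
  define C where "C a j = span (D (Suc a) j \<union> (if j = 0 then {} else D a (j - 1)) \<union> B)" for a j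
  have subD: "subspace (D a j)" for a j
    unfolding D_def using sub by (intro subspace_inter) auto
  have "\<exists>Z. Z \<subseteq> D a j \<and> p_indep Z (C a j) \<and> D a j \<subseteq> span (Z \<union> C a j)" for a j
  proof -
    have "subspace (C a j)" unfolding C_def by simp
    moreover have "p *s v \<in> C a j" if "v \<in> D a j" for v
      using pW that unfolding D_def C_def by (auto intro: span_base)
    ultimately show ?thesis by (rule p_basis_exists) blast+
  qed
  then obtain Zf where Zf: "\<And>a j. Zf a j \<subseteq> D a j" "\<And>a j. p_indep (Zf a j) (C a j)"
    "\<And>a j. D a j \<subseteq> span (Zf a j \<union> C a j)" by metis
  define Z where "Z = (\<Union>a j. Zf a j)"
  have "\<forall>z\<in>Z. \<exists>a j. z \<in> Zf a j" unfolding Z_def by auto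
  then obtain i d where id: "\<And>z. z \<in> Z \<Longrightarrow> z \<in> Zf (i z) (d z)" by metis
  then have ZD: "z \<in> D (i z) (d z)" if "z \<in> Z" for z using Zf(1) that by blast
  have Dspan: "D a j \<subseteq> span (Z \<union> B)" for a j
  proof (induction "j - a" arbitrary: a j)
    case 0
    then have "Q a \<subseteq> Q j" using Q(1) by (simp add: decseqD)
    then have "D a j \<subseteq> B" using QE[of j] unfolding D_def by blast
    then show ?case by (auto intro: span_base)
  next
    case (Suc e)
    then have "C a j \<subseteq> span (Z \<union> B)"
      unfolding C_def using Suc(1)[of j "Suc a"] Suc(1)[of "j - 1" a]
      by (intro span_minimal) (auto intro: span_base)
    then have "span (Zf a j \<union> C a j) \<subseteq> span (Z \<union> B)"
      by (intro span_minimal) (auto simp: Z_def intro!: span_base)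
    then show ?case using Zf(3) by blast
  qed
  show ?thesis
  proof (rule that[of Z i])
    show "Z \<subseteq> W" using ZD unfolding D_def by blast
    show "z \<in> Q (i z)" if "z \<in> Z" for z using ZD that unfolding D_def by blast
    show "W \<subseteq> span (Z \<union> B)"
    proof
      fix w assume w: "w \<in> W"
      then obtain j where "w \<in> E j" using E(2) by blast
      then have "w \<in> D 0 j" using w Q(2) unfolding D_def by blast
      then show "w \<in> span (Z \<union> B)" using Dspan by blast
    qed
  next
    fix F c a x
    assume F: "finite F" "F \<subseteq> Z" "(\<Sum>z\<in>F. c z *s z) \<in> span (Q a \<union> B)" "x \<in> F" "i x < a"
    show "p dvd c x"
    proof (rule ccontr)
      assume x: "\<not> p dvd c x"
      \<comment> \<open>Isolate a leading part of the offending terms: first the least filtration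
        index \<open>m\<close>, then among those the largest chain index \<open>k\<close>. The
        resulting \<open>?H\<close> lies in the single graded basis \<open>Zf m k\<close>.\<close>
      let ?F = "{z\<in>F. \<not> p dvd c z \<and> i z < a}"
      define m where "m = Min (i ` ?F)"
      have m: "m \<in> i ` ?F" "\<And>z. z \<in> ?F \<Longrightarrow> m \<le> i z"
        unfolding m_def using F(1,4,5) x by (auto intro!: Min_in Min_le)
      let ?G = "{z\<in>?F. i z = m}"
      define k where "k = Max (d ` ?G)"
      have G: "finite ?G" "?G \<noteq> {}" using m(1) F(1) by auto
      then have k: "k \<in> d ` ?G" "\<And>z. z \<in> ?G \<Longrightarrow> d z \<le> k"
        unfolding k_def by (auto intro!: Max_in Max_ge)
      let ?H = "{z\<in>?G. d z = k}"
      have ma: "Suc m \<le> a" using m(1) by auto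
      have pz: "p *s z \<in> B" if "z \<in> F" for z
        using pW ZD F(2) that unfolding D_def by blast
      have Qa: "Q b \<subseteq> Q (Suc m)" if "Suc m \<le> b" for b using Q(1) that by (simp add: decseqD)
      \<comment> \<open>A term outside \<open>?G\<close> has a coefficient divisible by
        \<open>p\<close>, hence lies in \<open>B\<close>, or has filtration index above
        \<open>m\<close>.\<close>
      have low: "c z *s z \<in> span (Q (Suc m) \<union> B)" if z: "z \<in> F - ?G" for z
      proof (cases "p dvd c z")
        case True
        then show ?thesis using dvd_scale_mem[OF sub(2)] pz z by (auto intro: span_base)
      next
        case False
        then have "Suc m \<le> i z" using m(2)[of z] z ma by (cases "i z < a") auto
        then have "z \<in> Q (Suc m)" using Qa ZD F(2) z unfolding D_def by blast
        then show ?thesis by (auto intro: span_scale span_base)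
      qed
      have "(\<Sum>z\<in>F. c z *s z) = (\<Sum>z\<in>?G. c z *s z) + (\<Sum>z\<in>F - ?G. c z *s z)"
        using F(1) by (intro sum.subset_diff[THEN trans[OF _ add.commute]]) auto
      moreover have "(\<Sum>z\<in>F. c z *s z) \<in> span (Q (Suc m) \<union> B)"
        using F(3) span_mono[of "Q a \<union> B" "Q (Suc m) \<union> B"] Qa[OF ma] by blast
      moreover have "(\<Sum>z\<in>F - ?G. c z *s z) \<in> span (Q (Suc m) \<union> B)"
        using low by (intro span_sum) blast
      ultimately have "(\<Sum>z\<in>?G. c z *s z) \<in> span (Q (Suc m) \<union> B)"
        by (rule subspace_summand[OF subspace_span])
      then obtain q b where qb: "q \<in> Q (Suc m)" "b \<in> B" "(\<Sum>z\<in>?G. c z *s z) = q + b"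
        using span_minimal[OF subset_refl sub(2)] span_minimal[OF subset_refl sub(3)]
        unfolding span_Un by blast
      \<comment> \<open>As \<open>B\<close> lies in both \<open>W\<close> and \<open>E k\<close>,
        subtracting \<open>b\<close> keeps the sum there. This places \<open>q\<close> in the
        neighbour \<open>D (Suc m) k\<close>.\<close>
      have "z \<in> W \<and> z \<in> E k" if "z \<in> ?G" for z
        using ZD[of z] k(2)[OF that] incseqD[OF E(1), of "d z" k] F(2) that unfolding D_def by blast
      then have "(\<Sum>z\<in>?G. c z *s z) \<in> W \<inter> E k"
        using sub by (intro subspace_sum subspace_scale subspace_inter) auto
      then have "(\<Sum>z\<in>?G. c z *s z) - b \<in> W \<inter> E k"
        using subspace_diff[OF subspace_inter[OF sub(1) sub(4)]] qb(2) BW BE by blast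
      then have "q \<in> D (Suc m) k" using qb unfolding D_def by auto
      then have GC: "(\<Sum>z\<in>?G. c z *s z) \<in> C m k"
        unfolding qb(3) C_def using qb(2) by (intro span_add) (auto intro: span_base)
      have "c z *s z \<in> C m k" if z: "z \<in> ?G - ?H" for z
      proof -
        have "d z \<le> k - 1" "k \<noteq> 0" using k(2)[of z] z by auto
        moreover have "z \<in> Q m \<inter> W" using ZD[of z] F(2) z unfolding D_def by auto
        moreover have "z \<in> E (k - 1)"
          using ZD[of z] F(2) z incseqD[OF E(1) \<open>d z \<le> k - 1\<close>] unfolding D_def by auto
        ultimately show ?thesis
          unfolding C_def D_def by (auto intro: span_scale span_base)
      qed
      then have "(\<Sum>z\<in>?G - ?H. c z *s z) \<in> C m k"
        unfolding C_def by (intro span_sum) blast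
      moreover have "(\<Sum>z\<in>?G. c z *s z) = (\<Sum>z\<in>?H. c z *s z) + (\<Sum>z\<in>?G - ?H. c z *s z)"
        using G(1) by (intro sum.subset_diff[THEN trans[OF _ add.commute]]) auto
      ultimately have "(\<Sum>z\<in>?H. c z *s z) \<in> C m k"
        using GC subspace_summand[of "C m k"] unfolding C_def by blast
      moreover have "?H \<subseteq> Zf m k" using id F(2) by auto
      moreover have "finite ?H" using F(1) by auto
      ultimately have "\<forall>z\<in>?H. p dvd c z" using p_indepD[OF Zf(2)[of m k], of ?H c] by blast
      then show False using k(1) by blast
    qed
  qed
qed

text \<open>Here and below the generators are indexed by socle elements: g z is a p-power root of z with
exponent h z.\<close>
lemma cyclic_basis_independent:
  assumes h: "\<And>z. z \<in> Z \<Longrightarrow> p ^ h z *s g z = z" and pz: "\<And>z. z \<in> Z \<Longrightarrow> p *s z = 0"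
    and ind: "p_indep Z {0}"
    and F: "finite F" "F \<subseteq> Z" "(\<Sum>z\<in>F. r z *s g z) = 0"
  shows "\<forall>z\<in>F. p ^ Suc (h z) dvd r z"
proof -
  obtain N where N: "\<And>z. z \<in> F \<Longrightarrow> Suc (h z) \<le> N"
    using F(1) by (metis finite_imageI finite_nat_set_iff_bounded_le imageI)
  \<comment> \<open>Downward induction on \<open>t\<close>: at \<open>N\<close> the exponent is 0
    and nothing is claimed, at 0 the claim is the full divisibility.\<close>
  have "\<forall>z\<in>F. p ^ (Suc (h z) - t) dvd r z" if "t \<le> N" for t
    using that
  proof (induction t rule: inc_induct)
    case base
    then show ?case using N by simp
  next
    case (step t)
    let ?G = "{z\<in>F. t \<le> h z}"
    have "\<forall>z\<in>F. \<exists>s. r z = p ^ (h z - t) * s" using step.IH by (auto simp: dvd_def)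
    then obtain s where s: "\<And>z. z \<in> F \<Longrightarrow> r z = p ^ (h z - t) * s z" by metis
    \<comment> \<open>Multiplication by \<open>p ^ t\<close> kills the generators of height below
      \<open>t\<close> and turns the remaining terms into multiples of socle elements, where
      independence of \<open>Z\<close> applies.\<close>
    have "(\<Sum>z\<in>F. (p ^ t * r z) *s g z) = p ^ t *s (\<Sum>z\<in>F. r z *s g z)"
      by (simp add: scale_sum_right)
    also have "\<dots> = 0" using F(3) by simp
    also have "(\<Sum>z\<in>F. (p ^ t * r z) *s g z) = (\<Sum>z\<in>?G. s z *s z)"
    proof (intro sum.mono_neutral_cong_right ballI F(1))
      fix z assume z: "z \<in> F - ?G"
      then have "Suc (h z) \<le> t" by auto
      then obtain d where "t = Suc (h z) + d" by (metis le_Suc_ex)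
      then have "p ^ t * r z = (p ^ d * r z * p) * p ^ h z"
        by (simp add: power_add mult_ac)
      then have "(p ^ t * r z) *s g z = (p ^ d * r z) *s p *s p ^ h z *s g z"
        by (simp only: scale_scale mult.assoc)
      moreover have "p ^ h z *s g z = z" "p *s z = 0" using h pz z F(2) by auto
      ultimately show "(p ^ t * r z) *s g z = 0" by (simp only: scale_zero_right)
    next
      fix z assume z: "z \<in> ?G"
      then have zF: "z \<in> F" and "p ^ h z = p ^ t * p ^ (h z - t)"
        by (auto simp flip: power_add)
      then have "p ^ t * r z = s z * p ^ h z" using s[OF zF] by (simp only: mult_ac)
      then have "(p ^ t * r z) *s g z = s z *s p ^ h z *s g z" by (simp only: scale_scale)
      moreover have "p ^ h z *s g z = z" using h zF F(2) by blast
      ultimately show "(p ^ t * r z) *s g z = s z *s z" by (simp only:)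
    qed auto
    finally have "(\<Sum>z\<in>?G. s z *s z) \<in> {0}" by simp
    moreover have "finite ?G" "?G \<subseteq> Z" using F(1,2) by auto
    ultimately have G: "\<forall>z\<in>?G. p dvd s z"
      using p_indepD[OF ind, of ?G s] by blast
    show ?case
    proof (intro ballI)
      fix z assume z: "z \<in> F"
      show "p ^ (Suc (h z) - t) dvd r z"
      proof (cases "t \<le> h z")
        case True
        then have "p dvd s z" using G z by blast
        then have "p ^ (h z - t) * p dvd p ^ (h z - t) * s z" by (rule mult_dvd_mono[OF dvd_refl])
        then show ?thesis using s[OF z] True by (simp only: Suc_diff_le power_Suc2)
      qed simp
    qed
  qed
  from this[of 0] show ?thesis by simp
qed

text \<open>Induction on the exponent of \<open>v\<close>. The last nonzero power multiple lies in
  the socle, and adaptedness leaves only basis elements of height at least \<open>e\<close> in its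
  expansion. These can be divided by \<open>p ^ e\<close>; subtracting the quotient
  \<open>?w\<close> lowers the exponent.\<close>

lemma cyclic_basis_spans:
  assumes h: "\<And>z. z \<in> Z \<Longrightarrow> p ^ h z *s g z = z" and pz: "\<And>z. z \<in> Z \<Longrightarrow> p *s z = 0"
    and socle: "{v. p *s v = 0} \<subseteq> span Z"
    and height: "\<And>F c e v z. finite F \<Longrightarrow> F \<subseteq> Z \<Longrightarrow> (\<Sum>z\<in>F. c z *s z) = p ^ e *s v \<Longrightarrow>
      z \<in> F \<Longrightarrow> h z < e \<Longrightarrow> p dvd c z"
    and torsion: "p ^ e *s v = 0"
  shows "v \<in> span (g ` Z)"
  using torsion
proof (induction e arbitrary: v)
  case 0
  then show ?case by (simp add: span_zero)
next
  case (Suc e)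
  then have "p ^ e *s v \<in> span ((\<lambda>z. z) ` Z)" using socle by (auto simp: mult.commute)
  then obtain F c where F: "finite F" "F \<subseteq> Z" "p ^ e *s v = (\<Sum>z\<in>F. c z *s z)"
    by (rule span_coords[of _ _ _ "{}"]) auto
  let ?G = "{z\<in>F. e \<le> h z}"
  let ?w = "\<Sum>z\<in>?G. (c z * p ^ (h z - e)) *s g z"
  have "(\<Sum>z\<in>F. c z *s z) = (\<Sum>z\<in>?G. (p ^ e * (c z * p ^ (h z - e))) *s g z)"
  proof (intro sum.mono_neutral_cong_right ballI F(1))
    fix z assume z: "z \<in> F - ?G"
    then have "p dvd c z" using height[OF F(1,2) F(3)[symmetric], of z] by auto
    moreover have "p *s z = 0" using pz z F(2) by auto
    ultimately show "c z *s z = 0"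
      using dvd_scale_mem[OF subspace_single_0, of z "c z"] by simp
  next
    fix z assume z: "z \<in> ?G"
    then have "p ^ e * (c z * p ^ (h z - e)) = c z * p ^ h z"
      using power_add[of p e "h z - e"] by (simp add: mult_ac)
    moreover have "p ^ h z *s g z = z" using h z F(2) by auto
    ultimately show "c z *s z = (p ^ e * (c z * p ^ (h z - e))) *s g z" by (metis scale_scale)
  qed auto
  also have "\<dots> = p ^ e *s ?w" by (simp add: scale_sum_right)
  finally have "p ^ e *s (v - ?w) = 0" using F(3) by (simp add: scale_right_diff_distrib)
  then have "v - ?w \<in> span (g ` Z)" by (rule Suc.IH)
  moreover have "?w \<in> span (g ` Z)"
    using F(2) by (intro span_sum span_scale span_base) auto
  ultimately show ?case by (metis diff_add_cancel span_add)
qed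

subsection \<open>Existence of picket decompositions\<close>

lemma pow_dvd_imp_dvd: "p ^ m dvd p ^ e * r \<Longrightarrow> e < m \<Longrightarrow> p dvd r"
  using pow_dvd_cancel_le[of e m r] dvd_trans[OF dvd_power[of "m - e" p]] by simp

lemma subspace_socle: "subspace {v. p *s v = 0}"
  by (rule module_hom.subspace_kernel[OF module_hom_scale_self])

lemma span_Un_0: "span (Z \<union> {0}) = span Z"
proof (rule antisym)
  show "span (Z \<union> {0}) \<subseteq> span Z"
    by (rule span_minimal) (auto intro: span_base span_zero)
  show "span Z \<subseteq> span (Z \<union> {0})"
    by (rule span_mono) auto
qed

section \<open>Ascending chains from decompositions into cyclic modules\<close>

text \<open>If \<open>p ^ j *s v\<close> lies in \<open>E j\<close>, its coordinates there agree
  modulo \<open>U\<close> with \<open>p ^ j\<close> times those of \<open>v\<close>. Summands of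
  exponent at most \<open>j\<close> are killed by \<open>p ^ j\<close>, so all these coordinates
  vanish modulo \<open>U\<close>.\<close>

lemma sigma_cyc_chain:
  assumes U: "subspace U" and "sigma_cyc_quot scale p U"
  obtains E where "\<And>j. subspace (E j)" "\<And>j. U \<subseteq> E j" "incseq E" "(\<Union>j. E j) = UNIV"
    "\<And>j v. p ^ j *s v \<in> E j \<Longrightarrow> p ^ j *s v \<in> U"
proof -
  obtain X n where "(\<forall>x\<in>X. 1 \<le> n x \<and> {r. r *s x \<in> U} = {r. p ^ n x dvd r}) \<and>
      (\<forall>m. \<exists>F r. finite F \<and> F \<subseteq> X \<and> m - (\<Sum>x\<in>F. r x *s x) \<in> U) \<and>
      (\<forall>F r. finite F \<and> F \<subseteq> X \<and> (\<Sum>x\<in>F. r x *s x) \<in> U \<longrightarrow> (\<forall>x\<in>F. r x *s x \<in> U))"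
    using assms(2) unfolding sigma_cyc_quot_def by (elim exE) (erule that)
  then have X: "\<And>x. x \<in> X \<Longrightarrow> {r. r *s x \<in> U} = {r. p ^ n x dvd r}"
    and gen: "\<And>m. \<exists>F r. finite F \<and> F \<subseteq> X \<and> m - (\<Sum>x\<in>F. r x *s x) \<in> U"
    and dir: "\<And>F r. finite F \<and> F \<subseteq> X \<and> (\<Sum>x\<in>F. r x *s x) \<in> U \<Longrightarrow> \<forall>x\<in>F. r x *s x \<in> U"
    by simp_all
  define E where "E j = span ({x\<in>X. n x \<le> j} \<union> U)" for j :: nat
  have mem: "r *s x \<in> U \<longleftrightarrow> p ^ n x dvd r" if "x \<in> X" for x r
    using X that by blast
  have EU: "m \<in> (\<Union>j. E j)" for m
  proof -
    obtain F r where F: "finite F" "F \<subseteq> X" "m - (\<Sum>x\<in>F. r x *s x) \<in> U" using gen by blast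
    obtain N where N: "\<And>x. x \<in> F \<Longrightarrow> n x \<le> N"
      using F(1) by (metis finite_imageI finite_nat_set_iff_bounded_le imageI)
    have "(\<Sum>x\<in>F. r x *s x) \<in> E N"
      unfolding E_def using F(2) N by (intro span_sum span_scale span_base) auto
    moreover have "m - (\<Sum>x\<in>F. r x *s x) \<in> E N" unfolding E_def using F(3) by (auto intro: span_base)
    ultimately have "(m - (\<Sum>x\<in>F. r x *s x)) + (\<Sum>x\<in>F. r x *s x) \<in> E N"
      unfolding E_def by (intro span_add)
    then show ?thesis by auto
  qed
  have EX: "E j \<subseteq> span ((\<lambda>x. x) ` X \<union> U)" for j
    unfolding E_def by (intro span_mono) auto
  show ?thesis
  proof (rule that[of E])
    show "incseq E" unfolding E_def by (intro monoI span_mono) auto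
    show "(\<Union>j. E j) = UNIV" using EU by blast
    fix j v assume "p ^ j *s v \<in> E j"
    then have "p ^ j *s v \<in> span ((\<lambda>x. x) ` {x\<in>X. n x \<le> j} \<union> U)" unfolding E_def by simp
    then obtain F c b where F: "finite F" "F \<subseteq> {x\<in>X. n x \<le> j}" "b \<in> U"
      "p ^ j *s v = (\<Sum>x\<in>F. c x *s x) + b"
      by (rule span_mod_coords[OF _ U, of _ _ _ "{}"]) auto
    have FX: "F \<subseteq> X" using F(2) by auto
    have "v \<in> span ((\<lambda>x. x) ` X \<union> U)" using EU[of v] EX by blast
    then obtain G d b' where G: "finite G" "F \<subseteq> G" "G \<subseteq> X" "b' \<in> U" "v = (\<Sum>x\<in>G. d x *s x) + b'"
      by (rule span_mod_coords[OF _ U F(1) FX])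
    \<comment> \<open>The difference of two coordinate vectors of \<open>p ^ j *s v\<close>, taken
      over the common support \<open>G\<close>; by directness every component of it lies in
      \<open>U\<close>.\<close>
    let ?e = "\<lambda>x. p ^ j * d x - (if x \<in> F then c x else 0)"
    have "(\<Sum>x\<in>G. ?e x *s x) = p ^ j *s (\<Sum>x\<in>G. d x *s x) - (\<Sum>x\<in>F. c x *s x)"
      unfolding sum_extend[OF G(1,2)] by (simp add: scale_left_diff_distrib sum_subtractf scale_sum_right)
    also have "p ^ j *s (\<Sum>x\<in>G. d x *s x) = p ^ j *s v - p ^ j *s b'"
      unfolding G(5) by (simp add: scale_right_distrib)
    also have "p ^ j *s v - p ^ j *s b' - (\<Sum>x\<in>F. c x *s x) = b - p ^ j *s b'"
      unfolding F(4) by simp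
    also have "\<dots> \<in> U" using F(3) G(4) U by (intro subspace_diff subspace_scale)
    finally have e: "\<forall>x\<in>G. ?e x *s x \<in> U" using dir[of G ?e] G(1,3) by blast
    have "c x *s x \<in> U" if x: "x \<in> F" for x
    proof -
      have xX: "x \<in> X" "n x \<le> j" using F(2) x by auto
      have "?e x *s x \<in> U" using e G(2) x by blast
      then have "p ^ n x dvd p ^ j * d x - c x" using mem[OF xX(1)] x by auto
      moreover have "p ^ n x dvd p ^ j * d x" using xX(2) by (intro dvd_mult2 le_imp_power_dvd)
      ultimately have "p ^ n x dvd p ^ j * d x - (p ^ j * d x - c x)" by (rule dvd_diff[rotated])
      then show ?thesis using mem[OF xX(1)] by simp
    qed
    then show "p ^ j *s v \<in> U"
      unfolding F(4) using F(3) by (intro subspace_add[OF U] subspace_sum[OF U])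
  qed (auto simp: E_def intro: span_base)
qed

text \<open>Zero is a multiple of every power of \<open>p\<close>, so in a vanishing combination the
  power can be chosen above the height of any given term.\<close>

lemma p_indep_of_height:
  assumes "\<And>F c e v z. finite F \<Longrightarrow> F \<subseteq> Z \<Longrightarrow> (\<Sum>z\<in>F. c z *s z) = p ^ e *s v \<Longrightarrow>
      z \<in> F \<Longrightarrow> h z < (e::nat) \<Longrightarrow> p dvd c z"
  shows "p_indep Z {0}"
  unfolding p_indep_def
proof (intro allI impI ballI, elim conjE)
  fix F c z assume F: "finite F" "F \<subseteq> Z" "(\<Sum>z\<in>F. c z *s z) \<in> {0}" "z \<in> F"
  then have "(\<Sum>z\<in>F. c z *s z) = p ^ Suc (h z) *s 0" by simp
  then show "p dvd c z" using assms F(1,2,4) by blast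
qed

text \<open>Passes from labels in \<open>Z\<close> to the generators themselves, since
  \<open>picket_decomp\<close> is indexed by module elements. Independence makes \<open>g\<close>
  injective, and \<open>inv_into\<close> carries the exponents over.\<close>

lemma picket_decompI:
  assumes U: "subspace U"
    and ind: "\<And>F r. finite F \<Longrightarrow> F \<subseteq> Z \<Longrightarrow> (\<Sum>z\<in>F. r z *s g z) = 0 \<Longrightarrow> \<forall>z\<in>F. p ^ Suc (h z) dvd r z"
    and ann: "\<And>z. z \<in> Z \<Longrightarrow> p ^ Suc (h z) *s g z = 0"
    and gen: "\<And>v. v \<in> span (g ` Z)"
    and k: "\<And>z. z \<in> Z \<Longrightarrow> k z \<le> Suc (h z)"
    and gU: "\<And>z. z \<in> Z \<Longrightarrow> p ^ (Suc (h z) - k z) *s g z \<in> U"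
    and Ug: "\<And>u. u \<in> U \<Longrightarrow> \<exists>F r. finite F \<and> F \<subseteq> Z \<and>
      u = (\<Sum>z\<in>F. (p ^ (Suc (h z) - k z) * r z) *s g z)"
  shows "\<exists>X n k'. picket_decomp scale p U X n k' \<and> (\<forall>x\<in>X. \<exists>z\<in>Z. n x = Suc (h z) \<and> k' x = k z)"
proof -
  have inj: "inj_on g Z"
  proof (rule inj_onI, rule ccontr)
    fix x y assume xy: "x \<in> Z" "y \<in> Z" "g x = g y" "x \<noteq> y"
    \<comment> \<open>Equal generators with different labels would give a relation with coefficient
      1.\<close>
    let ?r = "(\<lambda>_. - 1)(x := 1 :: 'r)"
    have "(\<Sum>z\<in>{x, y}. ?r z *s g z) = 0" using xy by simp
    then have "p ^ Suc (h x) dvd ?r x" using ind[of "{x, y}" ?r] xy by blast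
    then show False using pow_not_dvd_1[of "Suc (h x)"] by simp
  qed
  let ?i = "inv_into Z g"
  let ?n = "\<lambda>x. Suc (h (?i x))"
  let ?k = "\<lambda>x. k (?i x)"
  have ig: "?i (g z) = z" if "z \<in> Z" for z using inj that by simp
  have reidx: "(\<Sum>x\<in>g ` F. f x) = (\<Sum>z\<in>F. f (g z))" if "F \<subseteq> Z" for F and f :: "'m \<Rightarrow> 'm"
    using inj_on_subset[OF inj that] by (simp add: sum.reindex)
  have "picket_decomp scale p U (g ` Z) ?n ?k"
    unfolding picket_decomp_def
  proof (intro conjI ballI allI impI)
    fix x assume "x \<in> g ` Z"
    then obtain z where z: "z \<in> Z" "x = g z" by blast
    show "1 \<le> ?n x" by simp
    show "?k x \<le> ?n x" using k z ig by simp
    have "r *s g z = 0 \<longleftrightarrow> p ^ Suc (h z) dvd r" for r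
    proof
      assume "r *s g z = 0"
      then show "p ^ Suc (h z) dvd r" using ind[of "{z}" "\<lambda>_. r"] z(1) by simp
    next
      assume "p ^ Suc (h z) dvd r"
      then obtain s where "r = s * p ^ Suc (h z)" by (metis dvdE mult.commute)
      then have "r *s g z = s *s p ^ Suc (h z) *s g z" by (simp only: scale_scale)
      then show "r *s g z = 0" using ann[OF z(1)] by (simp only: scale_zero_right)
    qed
    then show "{r. r *s x = 0} = {r. p ^ ?n x dvd r}" using z ig by auto
  next
    fix m
    obtain F c where F: "finite F" "F \<subseteq> Z" "m = (\<Sum>z\<in>F. c z *s g z)"
      by (rule span_coords[OF gen[of m], of "{}"]) auto
    have "m = (\<Sum>x\<in>g ` F. c (?i x) *s x)"
      unfolding reidx[OF F(2)] F(3) using F(2) ig by (intro sum.cong) auto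
    then show "\<exists>F r. finite F \<and> F \<subseteq> g ` Z \<and> m = (\<Sum>x\<in>F. r x *s x)"
      using F(1,2) by (intro exI[of _ "g ` F"] exI[of _ "\<lambda>x. c (?i x)"]) auto
  next
    fix F r x assume F: "finite F \<and> F \<subseteq> g ` Z \<and> (\<Sum>x\<in>F. r x *s x) = 0" and x: "x \<in> F"
    obtain G where G: "G \<subseteq> Z" "F = g ` G" "finite G"
      using finite_subset_image[of F g Z] F by auto
    have "(\<Sum>x\<in>F. r x *s x) = 0" using F by simp
    then have "(\<Sum>z\<in>G. r (g z) *s g z) = 0" unfolding G(2) reidx[OF G(1)] .
    then have d: "\<forall>z\<in>G. p ^ Suc (h z) dvd r (g z)" using ind[of G "\<lambda>z. r (g z)"] G by blast
    obtain z where z: "z \<in> G" "x = g z" using x G(2) by blast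
    obtain s where "r x = s * p ^ Suc (h z)" using d z by (metis dvdE mult.commute)
    then have "r x *s x = s *s p ^ Suc (h z) *s g z" using z(2) by (simp only: scale_scale)
    then show "r x *s x = 0" using ann[of z] z(1) G(1) by (metis scale_zero_right subsetD)
  next
    show "U = {(\<Sum>x\<in>F. (p ^ (?n x - ?k x) * r x) *s x) | F r. finite F \<and> F \<subseteq> g ` Z}" (is "_ = ?S")
    proof (intro antisym subsetI)
      fix u assume "u \<in> U"
      then obtain F r where F: "finite F" "F \<subseteq> Z"
        "u = (\<Sum>z\<in>F. (p ^ (Suc (h z) - k z) * r z) *s g z)" using Ug by blast
      have "u = (\<Sum>x\<in>g ` F. (p ^ (?n x - ?k x) * r (?i x)) *s x)"
        unfolding reidx[OF F(2)] F(3) using F(2) ig by (intro sum.cong) auto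
      then show "u \<in> ?S"
        using F(1,2) by (intro CollectI exI[of _ "g ` F"] exI[of _ "\<lambda>x. r (?i x)"]) auto
    next
      fix u assume "u \<in> ?S"
      then obtain F r where F: "F \<subseteq> g ` Z" "u = (\<Sum>x\<in>F. (p ^ (?n x - ?k x) * r x) *s x)" by blast
      have "(p ^ (?n x - ?k x) * r x) *s x \<in> U" if x: "x \<in> F" for x
      proof -
        obtain z where z: "z \<in> Z" "x = g z" using x F(1) by blast
        have "r x *s p ^ (Suc (h z) - k z) *s g z \<in> U" using gU[OF z(1)] by (rule subspace_scale[OF U])
        then show ?thesis using z ig by (simp add: mult.commute)
      qed
      then show "u \<in> U" unfolding F(2) by (rule subspace_sum[OF U])
    qed
  qed
  moreover have "\<forall>x\<in>g ` Z. \<exists>z\<in>Z. ?n x = Suc (h z) \<and> ?k x = k z" using ig by auto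
  ultimately show ?thesis by blast
qed

text \<open>The common last stage of (1) and (2): an adapted socle basis already decomposes M, and
  only the description of \<open>U\<close> by the chosen roots differs between the two
  cases.\<close>

lemma picket_decomp_of_socle_basis:
  assumes U: "subspace U"
    and g: "\<And>z. z \<in> Z \<Longrightarrow> p ^ h z *s g z = z" and Z: "Z \<subseteq> {v. p *s v = 0}"
    and socle: "{v. p *s v = 0} \<subseteq> span Z"
    and height: "\<And>F c e v z. finite F \<Longrightarrow> F \<subseteq> Z \<Longrightarrow> (\<Sum>z\<in>F. c z *s z) = p ^ e *s v \<Longrightarrow>
      z \<in> F \<Longrightarrow> h z < e \<Longrightarrow> p dvd c z"
    and torsion: "\<And>v. \<exists>e. p ^ e *s v = 0"
    and k: "\<And>z. z \<in> Z \<Longrightarrow> k z \<le> Suc (h z)"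
    and gU: "\<And>z. z \<in> Z \<Longrightarrow> p ^ (Suc (h z) - k z) *s g z \<in> U"
    and Ug: "\<And>u. u \<in> U \<Longrightarrow> \<exists>F r. finite F \<and> F \<subseteq> Z \<and>
      u = (\<Sum>z\<in>F. (p ^ (Suc (h z) - k z) * r z) *s g z)"
  shows "\<exists>X n k'. picket_decomp scale p U X n k' \<and> (\<forall>x\<in>X. \<exists>z\<in>Z. n x = Suc (h z) \<and> k' x = k z)"
proof (rule picket_decompI[OF U _ _ _ k gU Ug])
  have pz: "p *s z = 0" if "z \<in> Z" for z using Z that by blast
  have indep: "p_indep Z {0}" by (rule p_indep_of_height) (fact height)
  show "\<forall>z\<in>F. p ^ Suc (h z) dvd r z" if "finite F" "F \<subseteq> Z" "(\<Sum>z\<in>F. r z *s g z) = 0" for F r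
    by (rule cyclic_basis_independent[OF g pz indep that])
  show "v \<in> span (g ` Z)" for v
  proof -
    obtain e where "p ^ e *s v = 0" using torsion by blast
    then show ?thesis using cyclic_basis_spans[OF g pz socle] height by blast
  qed
  show "p ^ Suc (h z) *s g z = 0" if "z \<in> Z" for z
  proof -
    have "p ^ Suc (h z) *s g z = p *s p ^ h z *s g z" by (simp only: scale_scale power_Suc)
    then show ?thesis using g pz that by (simp only:)
  qed
qed

lemma sigma_cyc_torsion:
  assumes "sigma_cyc scale p"
  shows "\<exists>e. p ^ e *s v = 0"
proof -
  obtain E where E: "\<And>j. subspace (E j)" "(\<Union>j. E j) = UNIV"
    "\<And>j v. p ^ j *s v \<in> E j \<Longrightarrow> p ^ j *s v \<in> {0}"
    using sigma_cyc_chain[OF subspace_single_0 assms] by metis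
  obtain j where "v \<in> E j" using E(2) by blast
  then have "p ^ j *s v \<in> {0}" using E(3) subspace_scale[OF E(1)] by blast
  then show ?thesis by blast
qed

text \<open>The parity of the filtration index decides the picket. An odd index provides a root in
  \<open>U\<close>, so \<open>U\<close> contains the whole cyclic summand; an even index provides
  only a root in M, and \<open>U\<close> meets that summand in its multiples of
  \<open>p\<close>.\<close>

lemma picket_decomp_containing_pM:
  assumes U: "subspace U" and M: "sigma_cyc scale p" and pU: "\<And>m. p *s m \<in> U"
  shows "\<exists>X n k. picket_decomp scale p U X n k \<and> (\<forall>x\<in>X. k x = n x \<or> k x = n x - 1)"
proof -
  obtain E where E: "\<And>j. subspace (E j)" "\<And>j. {0} \<subseteq> E j" "incseq E" "(\<Union>j. E j) = UNIV"
    "\<And>j v. p ^ j *s v \<in> E j \<Longrightarrow> p ^ j *s v \<in> {0}"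
    using sigma_cyc_chain[OF subspace_single_0 M] by metis
  let ?S = "{v. p *s v = 0}"
  \<comment> \<open>The filtration of the socle by M, U, pM, pU, ...\<close>
  define T where "T i = (if even i then UNIV else U)" for i :: nat
  define Q where "Q i = (*s) (p ^ (i div 2)) ` T i" for i
  have subT: "subspace (T i)" for i unfolding T_def using U by simp
  have subQ: "subspace (Q i)" for i unfolding Q_def by (rule subspace_pow_image[OF subT])
  \<comment> \<open>Odd steps use that \<open>U\<close> is contained in M, even steps that pM is
    contained in \<open>U\<close>.\<close>
  have "Q (Suc i) \<subseteq> Q i" for i
  proof (cases "even i")
    case True
    then show ?thesis unfolding Q_def T_def by auto
  next
    case False
    then have "Suc i div 2 = Suc (i div 2)" by presburger
    then have "p ^ (Suc i div 2) *s v = p ^ (i div 2) *s p *s v" for v by (simp add: mult.commute)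
    then have "p ^ (Suc i div 2) *s v \<in> Q i" for v using False pU unfolding Q_def T_def by (metis image_eqI)
    then show ?thesis unfolding Q_def by blast
  qed
  then have decQ: "decseq Q" by (rule decseq_SucI)
  \<comment> \<open>Each power of \<open>p\<close> occupies two filtration steps, so the chain is
    slowed down by the same factor.\<close>
  have incE: "incseq (\<lambda>i. E (i div 2))"
    using E(3) by (auto simp: mono_def div_le_mono)
  have unE: "?S \<subseteq> (\<Union>i. E (i div 2))"
  proof
    fix v
    obtain j where "v \<in> E j" using E(4) by blast
    then have "v \<in> E (2 * j div 2)" by simp
    then show "v \<in> (\<Union>i. E (i div 2))" by blast
  qed
  have QE: "?S \<inter> Q j \<inter> E (j div 2) \<subseteq> {0}" for j
    using E(5) unfolding Q_def by blast
  obtain Z i where Z: "Z \<subseteq> ?S" "\<And>z. z \<in> Z \<Longrightarrow> z \<in> Q (i z)" "?S \<subseteq> span (Z \<union> {0})"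
    and val: "\<And>F c a z. finite F \<Longrightarrow> F \<subseteq> Z \<Longrightarrow> (\<Sum>z\<in>F. c z *s z) \<in> span (Q a \<union> {0}) \<Longrightarrow>
      z \<in> F \<Longrightarrow> i z < a \<Longrightarrow> p dvd c z"
  proof (rule filtered_p_basis[OF subspace_socle subspace_single_0 subQ E(1) _ E(2) _ decQ _ incE unE QE])
    show "{0} \<subseteq> ?S" by simp
    show "p *s w \<in> {0}" if "w \<in> ?S" for w using that by simp
    show "?S \<subseteq> Q 0" unfolding Q_def T_def by simp
  qed (rule that)
  define h where "h z = i z div 2" for z
  have "\<forall>z\<in>Z. \<exists>y\<in>T (i z). p ^ h z *s y = z" using Z(2) unfolding Q_def h_def image_iff by metis
  then obtain g where g: "\<And>z. z \<in> Z \<Longrightarrow> g z \<in> T (i z)" "\<And>z. z \<in> Z \<Longrightarrow> p ^ h z *s g z = z" by metis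
  \<comment> \<open>With n = \<open>Suc (h z)\<close> these values are n - 1 and n.\<close>
  define k where "k z = (if even (i z) then h z else Suc (h z))" for z
  have pz: "p *s z = 0" if "z \<in> Z" for z using Z(1) that by blast
  have height: "p dvd c z" if F: "finite F" "F \<subseteq> Z" "(\<Sum>z\<in>F. c z *s z) = p ^ e *s v" "z \<in> F" "h z < e"
    for F c e v z
  proof (rule val[OF F(1,2) _ F(4)])
    have "p ^ e *s v \<in> Q (2 * e)" unfolding Q_def T_def by simp
    then show "(\<Sum>z\<in>F. c z *s z) \<in> span (Q (2 * e) \<union> {0})" unfolding F(3) by (simp add: span_base)
    show "i z < 2 * e" using F(5) unfolding h_def by presburger
  qed
  have socle: "?S \<subseteq> span Z" using Z(3) unfolding span_Un_0 .
  \<comment> \<open>An element of \<open>U\<close> has no unit coefficient at a generator of even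
    index. Otherwise take the greatest height \<open>m\<close> of such a term: multiplying by
    \<open>p ^ m\<close> leaves only the offending terms of height \<open>m\<close> in p^m
    \<open>U\<close>, which is filtration step \<open>2 * m + 1\<close>, while their index is
    \<open>2 * m\<close>.\<close>
  have coeff: "p dvd r z" if F: "finite F" "F \<subseteq> Z" "(\<Sum>z\<in>F. r z *s g z) \<in> U" "z \<in> F" "even (i z)" for F r z
  proof (rule ccontr)
    assume z: "\<not> p dvd r z"
    let ?G = "{z\<in>F. even (i z) \<and> \<not> p dvd r z}"
    define m where "m = Max (h ` ?G)"
    have G: "finite ?G" "?G \<noteq> {}" using F z by auto
    then have m: "m \<in> h ` ?G" "\<And>z. z \<in> ?G \<Longrightarrow> h z \<le> m" unfolding m_def by (auto intro!: Max_in)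
    have "r y *s g y \<in> U" if y: "y \<in> F - ?G" for y
    proof (cases "even (i y)")
      case True
      then show ?thesis using dvd_scale_mem[OF U pU] y by auto
    next
      case False
      then have "g y \<in> U" using g(1)[of y] y F(2) unfolding T_def by auto
      then show ?thesis by (rule subspace_scale[OF U])
    qed
    then have "(\<Sum>z\<in>F - ?G. r z *s g z) \<in> U" by (rule subspace_sum[OF U])
    moreover have "(\<Sum>z\<in>F. r z *s g z) = (\<Sum>z\<in>?G. r z *s g z) + (\<Sum>z\<in>F - ?G. r z *s g z)"
      using F(1) by (intro sum.subset_diff[THEN trans[OF _ add.commute]]) auto
    ultimately have "(\<Sum>z\<in>?G. r z *s g z) \<in> U" using subspace_summand[OF U] F(3) by blast
    then have "p ^ m *s (\<Sum>z\<in>?G. r z *s g z) \<in> Q (Suc (2 * m))"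
      unfolding Q_def T_def by simp
    also have "p ^ m *s (\<Sum>z\<in>?G. r z *s g z) = (\<Sum>z\<in>?G. r z *s p ^ m *s g z)"
      by (simp add: scale_sum_right mult.commute)
    also have "\<dots> = (\<Sum>z\<in>{z\<in>?G. h z = m}. r z *s z)"
    proof (intro sum.mono_neutral_cong_right ballI G(1))
      fix z assume z: "z \<in> ?G - {z\<in>?G. h z = m}"
      then have "Suc (h z) \<le> m" using m(2)[of z] by auto
      then obtain d where "m = Suc (h z) + d" by (metis le_Suc_ex)
      then have "p ^ m *s g z = p ^ d *s p *s p ^ h z *s g z" by (simp add: power_add mult_ac)
      moreover have "p ^ h z *s g z = z" "p *s z = 0" using g(2) pz z F(2) by auto
      ultimately have "p ^ m *s g z = 0" by (simp only: scale_zero_right)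
      then show "r z *s p ^ m *s g z = 0" by simp
    next
      fix z assume "z \<in> {z\<in>?G. h z = m}"
      then have "p ^ m *s g z = z" using g(2)[of z] F(2) by auto
      then show "r z *s p ^ m *s g z = r z *s z" by (simp only:)
    qed auto
    finally have "(\<Sum>z\<in>{z\<in>?G. h z = m}. r z *s z) \<in> span (Q (Suc (2 * m)) \<union> {0})"
      by (simp add: span_base)
    moreover obtain y where y: "y \<in> F" "even (i y)" "\<not> p dvd r y" "h y = m" using m(1) by auto
    moreover have "i y < Suc (2 * m)" using y(2,4) unfolding h_def by presburger
    moreover have "finite {z\<in>?G. h z = m}" "{z\<in>?G. h z = m} \<subseteq> Z" using F by auto
    ultimately have "p dvd r y" using val[of "{z\<in>?G. h z = m}" r "Suc (2 * m)" y] by simp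
    then show False using y(3) by blast
  qed
  have gU: "p ^ (Suc (h z) - k z) *s g z \<in> U" if "z \<in> Z" for z
    using g(1)[OF that] pU unfolding k_def T_def by (auto split: if_splits)
  have Ug: "\<exists>F r. finite F \<and> F \<subseteq> Z \<and> u = (\<Sum>z\<in>F. (p ^ (Suc (h z) - k z) * r z) *s g z)"
    if u: "u \<in> U" for u
  proof -
    obtain e where "p ^ e *s u = 0" using sigma_cyc_torsion[OF M] by blast
    then have "u \<in> span (g ` Z)" using cyclic_basis_spans[OF g(2) pz socle] height by blast
    then obtain F r where F: "finite F" "F \<subseteq> Z" "u = (\<Sum>z\<in>F. r z *s g z)"
      by (rule span_coords[of _ _ _ "{}"]) auto
    have "\<exists>s. r z = p ^ (Suc (h z) - k z) * s" if z: "z \<in> F" for z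
    proof (cases "even (i z)")
      case True
      then have "p dvd r z" using coeff[OF F(1,2) _ z] u F(3) by blast
      then show ?thesis using True unfolding k_def by (simp add: dvd_def)
    next
      case False
      then show ?thesis unfolding k_def by simp
    qed
    then obtain s where "\<And>z. z \<in> F \<Longrightarrow> r z = p ^ (Suc (h z) - k z) * s z" by metis
    then have "u = (\<Sum>z\<in>F. (p ^ (Suc (h z) - k z) * s z) *s g z)"
      unfolding F(3) by (intro sum.cong) auto
    then show ?thesis using F(1,2) by blast
  qed
  have kle: "k z \<le> Suc (h z)" for z unfolding k_def by simp
  have "\<exists>X n k'. picket_decomp scale p U X n k' \<and> (\<forall>x\<in>X. \<exists>z\<in>Z. n x = Suc (h z) \<and> k' x = k z)"
    by (rule picket_decomp_of_socle_basis[OF U g(2) Z(1) socle _ sigma_cyc_torsion[OF M] kle gU Ug]) (assumption | fact height)+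
  then obtain X n k' where X: "picket_decomp scale p U X n k'" "\<forall>x\<in>X. \<exists>z\<in>Z. n x = Suc (h z) \<and> k' x = k z"
    by (elim exE conjE)
  have "\<forall>x\<in>X. k' x = n x \<or> k' x = n x - 1"
  proof
    fix x assume "x \<in> X"
    then obtain z where "n x = Suc (h z)" "k' x = k z" using X(2) by blast
    then show "k' x = n x \<or> k' x = n x - 1" unfolding k_def by auto
  qed
  then show ?thesis using X(1) by blast
qed

text \<open>The basis \<open>Z1\<close> of \<open>U\<close> yields the pickets with k = 1, and the
  basis \<open>Z2\<close> of the socle modulo \<open>U\<close> those with k = 0. Adaptedness modulo
  \<open>U\<close> means that each element of \<open>Z2\<close> has the largest height in its coset;
  the chain for this comes from the decomposition of M/U.\<close>

lemma picket_decomp_socle_submodule: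
  assumes U: "subspace U" and M: "sigma_cyc scale p" and pU: "\<And>u. u \<in> U \<Longrightarrow> p *s u = 0"
    and MU: "sigma_cyc_quot scale p U"
  shows "\<exists>X n k. picket_decomp scale p U X n k \<and> (\<forall>x\<in>X. k x = 0 \<or> k x = 1)"
proof -
  obtain E where E: "\<And>j. subspace (E j)" "\<And>j. {0} \<subseteq> E j" "incseq E" "(\<Union>j. E j) = UNIV"
    "\<And>j v. p ^ j *s v \<in> E j \<Longrightarrow> p ^ j *s v \<in> {0}"
    using sigma_cyc_chain[OF subspace_single_0 M] by metis
  obtain E' where E': "\<And>j. subspace (E' j)" "\<And>j. U \<subseteq> E' j" "incseq E'" "(\<Union>j. E' j) = UNIV"
    "\<And>j v. p ^ j *s v \<in> E' j \<Longrightarrow> p ^ j *s v \<in> U"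
    using sigma_cyc_chain[OF U MU] by metis
  let ?S = "{v. p *s v = 0}"
  define Q where "Q a = (*s) (p ^ a) ` UNIV" for a
  have subQ: "subspace (Q a)" for a unfolding Q_def by (rule subspace_pow_image[OF subspace_UNIV])
  have "Q (Suc a) \<subseteq> Q a" for a
  proof -
    have "p ^ Suc a *s v = p ^ a *s p *s v" for v by (simp add: mult.commute)
    then have "p ^ Suc a *s v \<in> Q a" for v unfolding Q_def by (metis rangeI)
    then show ?thesis unfolding Q_def by blast
  qed
  then have decQ: "decseq Q" by (rule decseq_SucI)
  have Q0: "V \<subseteq> Q 0" for V unfolding Q_def by simp
  have US: "U \<subseteq> ?S" using pU by blast
  have QE: "U \<inter> Q j \<inter> E j \<subseteq> {0}" for j using E(5) unfolding Q_def by blast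
  have QE': "?S \<inter> Q j \<inter> E' j \<subseteq> U" for j using E'(5) unfolding Q_def by blast
  obtain Z1 i1 where Z1: "Z1 \<subseteq> U" "\<And>z. z \<in> Z1 \<Longrightarrow> z \<in> Q (i1 z)" "U \<subseteq> span (Z1 \<union> {0})"
    and val1: "\<And>F c a z. finite F \<Longrightarrow> F \<subseteq> Z1 \<Longrightarrow> (\<Sum>z\<in>F. c z *s z) \<in> span (Q a \<union> {0}) \<Longrightarrow>
      z \<in> F \<Longrightarrow> i1 z < a \<Longrightarrow> p dvd c z"
  proof (rule filtered_p_basis[OF U subspace_single_0 subQ E(1) _ E(2) _ decQ Q0 E(3) _ QE])
    show "{0} \<subseteq> U" using subspace_0[OF U] by simp
    show "p *s w \<in> {0}" if "w \<in> U" for w using pU that by simp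
    show "U \<subseteq> (\<Union>j. E j)" using E(4) by simp
  qed (rule that)
  obtain Z2 i2 where Z2: "Z2 \<subseteq> ?S" "\<And>z. z \<in> Z2 \<Longrightarrow> z \<in> Q (i2 z)" "?S \<subseteq> span (Z2 \<union> U)"
    and val2: "\<And>F c a z. finite F \<Longrightarrow> F \<subseteq> Z2 \<Longrightarrow> (\<Sum>z\<in>F. c z *s z) \<in> span (Q a \<union> U) \<Longrightarrow>
      z \<in> F \<Longrightarrow> i2 z < a \<Longrightarrow> p dvd c z"
  proof (rule filtered_p_basis[OF subspace_socle U subQ E'(1) US E'(2) _ decQ Q0 E'(3) _ QE'])
    show "p *s w \<in> U" if "w \<in> ?S" for w using that subspace_0[OF U] by simp
    show "?S \<subseteq> (\<Union>j. E' j)" using E'(4) by simp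
  qed (rule that)
  let ?Z = "Z1 \<union> Z2"
  define h where "h z = (if z \<in> Z1 then i1 z else i2 z)" for z
  define k :: "'m \<Rightarrow> nat" where "k z = (if z \<in> Z1 then 1 else 0)" for z
  have ZS: "?Z \<subseteq> ?S" using Z1(1) Z2(1) US by blast
  have ZQ: "z \<in> Q (h z)" if "z \<in> ?Z" for z using that Z1(2) Z2(2) unfolding h_def by auto
  have "\<exists>y. p ^ h z *s y = z" if "z \<in> ?Z" for z
    using ZQ[OF that] unfolding Q_def by (metis imageE)
  then obtain g where g: "\<And>z. z \<in> ?Z \<Longrightarrow> p ^ h z *s g z = z" by metis
  have U_span: "U \<subseteq> span Z1" using Z1(3) unfolding span_Un_0 .
  then have "Z2 \<union> U \<subseteq> span ?Z" using span_mono[of Z1 ?Z] by (auto intro: span_base)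
  then have socle: "?S \<subseteq> span ?Z" using Z2(3) span_minimal[OF _ subspace_span] by blast
  have height: "p dvd c z" if F: "finite F" "F \<subseteq> ?Z" "(\<Sum>z\<in>F. c z *s z) = p ^ e *s v" "z \<in> F" "h z < e"
    for F c e v z
  proof -
    \<comment> \<open>Working modulo \<open>U\<close> first controls the coefficients on
      \<open>Z2\<close>. The \<open>Z2\<close> part then lies in p^e M, so it can be subtracted, and
      adaptedness of \<open>Z1\<close> treats the rest.\<close>
    let ?F1 = "F \<inter> Z1" and ?F2 = "F - Z1"
    have split: "(\<Sum>z\<in>F. c z *s z) = (\<Sum>z\<in>?F1. c z *s z) + (\<Sum>z\<in>?F2. c z *s z)"
      using F(1) by (rule sum.Int_Diff)
    have F2: "finite ?F2" "?F2 \<subseteq> Z2" using F(1,2) by auto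
    have "(\<Sum>z\<in>F. c z *s z) \<in> Q e" unfolding F(3) Q_def by blast
    then have sumQ: "(\<Sum>z\<in>F. c z *s z) \<in> span (Q e \<union> V)" for V by (simp add: span_base)
    have "(\<Sum>z\<in>?F1. c z *s z) \<in> U" using Z1(1) by (intro subspace_sum[OF U] subspace_scale[OF U]) auto
    then have "(\<Sum>z\<in>?F1. c z *s z) \<in> span (Q e \<union> U)" by (simp add: span_base)
    then have "(\<Sum>z\<in>?F2. c z *s z) \<in> span (Q e \<union> U)"
      using subspace_summand[OF subspace_span trans[OF split add.commute] sumQ] by blast
    then have div2: "p dvd c y" if "y \<in> ?F2" "i2 y < e" for y using val2[OF F2] that by blast
    have "c y *s y \<in> Q e" if y: "y \<in> ?F2" for y
    proof (cases "i2 y < e")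
      case True
      moreover have "p *s y \<in> Q e" using y F2(2) Z2(1) subspace_0[OF subQ] by auto
      ultimately show ?thesis using dvd_scale_mem[OF subQ] div2 y by blast
    next
      case False
      then have "y \<in> Q e" using y F2(2) Z2(2) decseqD[OF decQ, of e "i2 y"] by auto
      then show ?thesis by (rule subspace_scale[OF subQ])
    qed
    then have "(\<Sum>z\<in>?F2. c z *s z) \<in> Q e" by (rule subspace_sum[OF subQ])
    then have "(\<Sum>z\<in>?F2. c z *s z) \<in> span (Q e \<union> {0})" by (simp add: span_base)
    then have "(\<Sum>z\<in>?F1. c z *s z) \<in> span (Q e \<union> {0})"
      using subspace_summand[OF subspace_span split sumQ] by blast
    then have div1: "p dvd c y" if "y \<in> ?F1" "i1 y < e" for y
      using val1[of ?F1 c e y] that F(1) by blast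
    show ?thesis
      using div1 div2 F(4,5) unfolding h_def by (cases "z \<in> Z1") auto
  qed
  have kle: "k z \<le> Suc (h z)" for z unfolding k_def by simp
  have gU: "p ^ (Suc (h z) - k z) *s g z \<in> U" if z: "z \<in> ?Z" for z
  proof (cases "z \<in> Z1")
    case True
    then show ?thesis using g[OF z] Z1(1) unfolding k_def by auto
  next
    case False
    have "p ^ Suc (h z) *s g z = p *s p ^ h z *s g z" by (simp only: scale_scale power_Suc)
    also have "\<dots> = 0" using g[OF z] ZS z by auto
    finally show ?thesis using False subspace_0[OF U] unfolding k_def by simp
  qed
  have Ug: "\<exists>F r. finite F \<and> F \<subseteq> ?Z \<and> u = (\<Sum>z\<in>F. (p ^ (Suc (h z) - k z) * r z) *s g z)"
    if u: "u \<in> U" for u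
  proof -
    have "u \<in> span ((\<lambda>z. z) ` Z1)" using u U_span by auto
    then obtain F c where F: "finite F" "F \<subseteq> Z1" "u = (\<Sum>z\<in>F. c z *s z)"
      by (rule span_coords[of _ _ _ "{}"]) auto
    have "c z *s z = (p ^ (Suc (h z) - k z) * c z) *s g z" if z: "z \<in> F" for z
    proof -
      have "(p ^ (Suc (h z) - k z) * c z) *s g z = c z *s p ^ h z *s g z"
        using z F(2) unfolding k_def by (auto simp: mult.commute)
      moreover have "p ^ h z *s g z = z" using g z F(2) by blast
      ultimately show ?thesis by (simp only:)
    qed
    then have "u = (\<Sum>z\<in>F. (p ^ (Suc (h z) - k z) * c z) *s g z)"
      unfolding F(3) by (intro sum.cong) auto
    then show ?thesis using F(1,2) by blast
  qed
  have "\<exists>X n k'. picket_decomp scale p U X n k' \<and> (\<forall>x\<in>X. \<exists>z\<in>?Z. n x = Suc (h z) \<and> k' x = k z)"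
    by (rule picket_decomp_of_socle_basis[OF U g ZS socle _ sigma_cyc_torsion[OF M] kle gU Ug]) (assumption | fact height)+
  then obtain X n k' where X: "picket_decomp scale p U X n k'" "\<forall>x\<in>X. \<exists>z\<in>?Z. n x = Suc (h z) \<and> k' x = k z"
    by (elim exE conjE)
  have "\<forall>x\<in>X. k' x = 0 \<or> k' x = 1" using X(2) unfolding k_def by metis
  then show ?thesis using X(1) by blast
qed

subsection \<open>Invariants of a picket decomposition\<close>

lemma picket_decompD:
  assumes "picket_decomp scale p U X n k"
  shows "\<And>x. x \<in> X \<Longrightarrow> 1 \<le> n x \<and> k x \<le> n x"
    and "\<And>x r. x \<in> X \<Longrightarrow> r *s x = 0 \<longleftrightarrow> p ^ n x dvd r"
    and "\<And>m. \<exists>F r. finite F \<and> F \<subseteq> X \<and> m = (\<Sum>x\<in>F. r x *s x)"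
    and "\<And>F r x. finite F \<Longrightarrow> F \<subseteq> X \<Longrightarrow> (\<Sum>x\<in>F. r x *s x) = 0 \<Longrightarrow> x \<in> F \<Longrightarrow> p ^ n x dvd r x"
    and "U = {(\<Sum>x\<in>F. (p ^ (n x - k x) * r x) *s x) | F r. finite F \<and> F \<subseteq> X}"
proof -
  note P = assms[unfolded picket_decomp_def]
  note D = P[THEN conjunct1] P[THEN conjunct2, THEN conjunct1] P[THEN conjunct2, THEN conjunct2, THEN conjunct1]
    P[THEN conjunct2, THEN conjunct2, THEN conjunct2]
  show "1 \<le> n x \<and> k x \<le> n x" if "x \<in> X" for x using D(1) that by simp
  show ann: "r *s x = 0 \<longleftrightarrow> p ^ n x dvd r" if "x \<in> X" for x r
  proof -
    have "{r. r *s x = 0} = {r. p ^ n x dvd r}" using bspec[OF D(1) that] by (elim conjE)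
    then show ?thesis by (simp add: set_eq_iff)
  qed
  show "\<exists>F r. finite F \<and> F \<subseteq> X \<and> m = (\<Sum>x\<in>F. r x *s x)" for m by (rule spec[OF D(2)])
  show "p ^ n x dvd r x" if "finite F" "F \<subseteq> X" "(\<Sum>x\<in>F. r x *s x) = 0" "x \<in> F" for F r x
  proof -
    have "r x *s x = 0" using D(3) that by blast
    then show ?thesis using ann that(2,4) by blast
  qed
  show "U = {(\<Sum>x\<in>F. (p ^ (n x - k x) * r x) *s x) | F r. finite F \<and> F \<subseteq> X}" by (rule D(4))
qed

text \<open>Two expansions of one element differ by a relation, whose coefficient at
  \<open>x\<close> is divisible by \<open>p ^ n x\<close> and hence by the smaller power. So
  membership in \<open>U\<close> can be tested on any expansion.\<close>

lemma picket_decomp_sum_mem_iff: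
  assumes P: "picket_decomp scale p U X n k" and U: "subspace U" and F: "finite F" "F \<subseteq> X"
  shows "(\<Sum>x\<in>F. r x *s x) \<in> U \<longleftrightarrow> (\<forall>x\<in>F. p ^ (n x - k x) dvd r x)"
proof
  assume "\<forall>x\<in>F. p ^ (n x - k x) dvd r x"
  then have "\<forall>x\<in>F. \<exists>s. r x = p ^ (n x - k x) * s" by (simp add: dvd_def)
  then obtain s where "\<And>x. x \<in> F \<Longrightarrow> r x = p ^ (n x - k x) * s x" by metis
  then have "(\<Sum>x\<in>F. r x *s x) = (\<Sum>x\<in>F. (p ^ (n x - k x) * s x) *s x)"
    by (intro sum.cong) auto
  then show "(\<Sum>x\<in>F. r x *s x) \<in> U" using picket_decompD(5)[OF P] F by blast
next
  assume "(\<Sum>x\<in>F. r x *s x) \<in> U"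
  then obtain G s where G: "finite G" "G \<subseteq> X"
    "(\<Sum>x\<in>F. r x *s x) = (\<Sum>x\<in>G. (p ^ (n x - k x) * s x) *s x)"
    using picket_decompD(5)[OF P] by blast
  let ?e = "\<lambda>x. (if x \<in> F then r x else 0) - (if x \<in> G then p ^ (n x - k x) * s x else 0)"
  have fin: "finite (F \<union> G)" "F \<union> G \<subseteq> X" using F G(1,2) by auto
  have "(\<Sum>x\<in>F \<union> G. ?e x *s x) = 0"
    using G(3) sum_extend[OF fin(1), of F r "\<lambda>x. x"]
      sum_extend[OF fin(1), of G "\<lambda>x. p ^ (n x - k x) * s x" "\<lambda>x. x"]
    by (simp add: scale_left_diff_distrib sum_subtractf)
  then have e: "p ^ n x dvd ?e x" if "x \<in> F" for x
    using picket_decompD(4)[OF P fin, of ?e x] that by blast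
  show "\<forall>x\<in>F. p ^ (n x - k x) dvd r x"
  proof
    fix x assume x: "x \<in> F"
    have "p ^ (n x - k x) dvd ?e x" using dvd_trans[OF le_imp_power_dvd e[OF x]] by simp
    moreover have "p ^ (n x - k x) dvd (if x \<in> G then p ^ (n x - k x) * s x else 0)" by simp
    ultimately have "p ^ (n x - k x) dvd ?e x + (if x \<in> G then p ^ (n x - k x) * s x else 0)"
      by (rule dvd_add)
    then show "p ^ (n x - k x) dvd r x" using x by simp
  qed
qed

text \<open>Modulo \<open>U\<close> a picket of type (n, k) becomes cyclic of exponent n - k; those
  with k = n disappear. This is the forward implication of (2).\<close>

lemma sigma_cyc_quot_of_picket_decomp:
  assumes P: "picket_decomp scale p U X n k" and U: "subspace U"
  shows "sigma_cyc_quot scale p U"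
proof -
  note mem = picket_decomp_sum_mem_iff[OF P U]
  let ?X = "{x\<in>X. k x < n x}"
  have mem1: "r *s x \<in> U \<longleftrightarrow> p ^ (n x - k x) dvd r" if "x \<in> X" for x r
    using mem[of "{x}" "\<lambda>_. r"] that by simp
  show ?thesis
    unfolding sigma_cyc_quot_def
  proof (rule exI[of _ ?X], rule exI[of _ "\<lambda>x. n x - k x"], intro conjI allI impI ballI)
    fix x assume x: "x \<in> ?X"
    then show "1 \<le> n x - k x" by auto
    show "{r. r *s x \<in> U} = {r. p ^ (n x - k x) dvd r}" using mem1 x by simp
  next
    fix m
    obtain F r where F: "finite F" "F \<subseteq> X" "m = (\<Sum>x\<in>F. r x *s x)"
      using picket_decompD(3)[OF P] by blast
    have "m = (\<Sum>x\<in>F \<inter> ?X. r x *s x) + (\<Sum>x\<in>F - ?X. r x *s x)"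
      unfolding F(3) using F(1) by (rule sum.Int_Diff)
    then have "m - (\<Sum>x\<in>F \<inter> ?X. r x *s x) = (\<Sum>x\<in>F - ?X. r x *s x)" by simp
    also have "\<dots> \<in> U"
    proof (rule mem[of "F - ?X" r, THEN iffD2])
      show "finite (F - ?X)" "F - ?X \<subseteq> X" using F(1,2) by auto
      show "\<forall>x\<in>F - ?X. p ^ (n x - k x) dvd r x"
      proof
        fix x assume "x \<in> F - ?X"
        then have "n x - k x = 0" using F(2) by auto
        then show "p ^ (n x - k x) dvd r x" by simp
      qed
    qed
    finally show "\<exists>F r. finite F \<and> F \<subseteq> ?X \<and> m - (\<Sum>x\<in>F. r x *s x) \<in> U"
      using F(1) by (intro exI[of _ "F \<inter> ?X"] exI[of _ r]) auto
  next
    fix F r x assume F: "finite F \<and> F \<subseteq> ?X \<and> (\<Sum>x\<in>F. r x *s x) \<in> U" and x: "x \<in> F"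
    then have "F \<subseteq> X" by auto
    then have "p ^ (n x - k x) dvd r x" using mem[of F r] F x by blast
    then show "r x *s x \<in> U" using mem1 \<open>F \<subseteq> X\<close> x by blast
  qed
qed

section \<open>Subquotients that count the pickets of a given type\<close>

text \<open>The generator of a picket of type (n, k) lies here exactly when n \<le> a and n - k
  \<le> l.\<close>

definition bounded_part :: "'m set \<Rightarrow> nat \<Rightarrow> nat \<Rightarrow> 'm set" where
  "bounded_part U a l = {y. p ^ a *s y = 0 \<and> p ^ l *s y \<in> U}"

text \<open>Multiples of \<open>p\<close> are included so that the quotient is a space over R/(p).
  The case \<open>l = 0\<close> is separate because truncated subtraction would put the whole
  bounded part into its radical.\<close>

definition bounded_part_radical :: "'m set \<Rightarrow> nat \<Rightarrow> nat \<Rightarrow> 'm set" where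
  "bounded_part_radical U a l = span (bounded_part U (a - 1) l \<union>
     (if l = 0 then {} else bounded_part U a (l - 1)) \<union> range ((*s) p))"

lemma bounded_part_coords:
  assumes P: "picket_decomp scale p U X n k" and U: "subspace U"
    and F: "finite F" "F \<subseteq> X" "(\<Sum>x\<in>F. r x *s x) \<in> bounded_part U a l" and x: "x \<in> F"
  shows "p ^ n x dvd p ^ a * r x" "p ^ (n x - k x) dvd p ^ l * r x"
proof -
  have s: "p ^ b *s (\<Sum>x\<in>F. r x *s x) = (\<Sum>x\<in>F. (p ^ b * r x) *s x)" for b
    by (simp add: scale_sum_right)
  have "p ^ a *s (\<Sum>x\<in>F. r x *s x) = 0" "p ^ l *s (\<Sum>x\<in>F. r x *s x) \<in> U"
    using F(3) unfolding bounded_part_def by auto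
  then have "(\<Sum>x\<in>F. (p ^ a * r x) *s x) = 0" "(\<Sum>x\<in>F. (p ^ l * r x) *s x) \<in> U"
    unfolding s .
  then show "p ^ n x dvd p ^ a * r x" "p ^ (n x - k x) dvd p ^ l * r x"
    using picket_decompD(4)[OF P F(1,2), of "\<lambda>x. p ^ a * r x" x] x
      picket_decomp_sum_mem_iff[OF P U F(1,2), of "\<lambda>x. p ^ l * r x"] by blast+
qed

lemma pickets_p_indep:
  assumes P: "picket_decomp scale p U X n k" and U: "subspace U" and ab: "1 \<le> a" "b \<le> a"
  shows "p_indep {x\<in>X. n x = a \<and> k x = b} (bounded_part_radical U a (a - b))"
proof -
  let ?l = "a - b" and ?Y = "{x\<in>X. n x = a \<and> k x = b}"
  \<comment> \<open>N consists of the elements whose coordinates at the pickets of type (a, b) are divisible by p.\<close>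
  let ?g = "\<lambda>x. (if x \<in> ?Y then p else 1) *s x"
  let ?N = "span (?g ` X)"
  have gN: "r *s x \<in> ?N" if "x \<in> X" "x \<in> ?Y \<Longrightarrow> p dvd r" for x r
  proof (cases "x \<in> ?Y")
    case True
    then have "p *s x \<in> ?N" using that(1) by (intro span_base) auto
    then show ?thesis using dvd_scale_mem[OF subspace_span] that(2) True by blast
  next
    case False
    then have "?g x = x" by (simp only: if_False scale_one)
    then have "x \<in> ?N" using span_base[OF imageI[OF that(1)], of ?g] by (simp only:)
    then show ?thesis by (rule span_scale)
  qed
  \<comment> \<open>A bound smaller than that of type (a, b) supplies too few factors
    \<open>p\<close>, so the coordinate itself must contribute one.\<close>
  have part: "bounded_part U c d \<subseteq> ?N" if cd: "c < a \<or> d < ?l" for c d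
  proof
    fix y assume y: "y \<in> bounded_part U c d"
    obtain F r where F: "finite F" "F \<subseteq> X" "y = (\<Sum>x\<in>F. r x *s x)"
      using picket_decompD(3)[OF P] by blast
    have "p dvd r x" if "x \<in> F" "x \<in> ?Y" for x
      using bounded_part_coords[OF P U F(1,2) y[unfolded F(3)] that(1)] that(2) cd pow_dvd_imp_dvd by blast
    then show "y \<in> ?N" unfolding F(3) using F(2) by (intro span_sum gN) auto
  qed
  have "p *s y \<in> ?N" for y
  proof -
    obtain F r where F: "finite F" "F \<subseteq> X" "y = (\<Sum>x\<in>F. r x *s x)"
      using picket_decompD(3)[OF P] by blast
    have "p *s y = (\<Sum>x\<in>F. (p * r x) *s x)" unfolding F(3) by (simp add: scale_sum_right)
    also have "\<dots> \<in> ?N" using F(2) by (intro span_sum gN) auto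
    finally show ?thesis .
  qed
  then have radical: "bounded_part_radical U a ?l \<subseteq> ?N"
    unfolding bounded_part_radical_def using part[of "a - 1" ?l] part[of a "?l - 1"] ab(1)
    by (intro span_minimal) auto
  show ?thesis
    unfolding p_indep_def
  proof (intro allI impI ballI, elim conjE)
    fix F c x
    assume F: "finite F" "F \<subseteq> ?Y" "(\<Sum>z\<in>F. c z *s z) \<in> bounded_part_radical U a ?l" and x: "x \<in> F"
    have FX: "F \<subseteq> X" using F(2) by auto
    have "(\<Sum>z\<in>F. c z *s z) \<in> ?N" using F(3) radical by blast
    then obtain G d where G: "finite G" "F \<subseteq> G" "G \<subseteq> X" "(\<Sum>z\<in>F. c z *s z) = (\<Sum>z\<in>G. d z *s ?g z)"
      by (rule span_coords[OF _ F(1) FX])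
    \<comment> \<open>Comparing coordinates over \<open>G\<close>: at \<open>x\<close> the second
      expansion carries a factor \<open>p\<close>, and \<open>p ^ a\<close> with a \<ge> 1 divides
      the difference.\<close>
    let ?e = "\<lambda>z. (if z \<in> F then c z else 0) - d z * (if z \<in> ?Y then p else 1)"
    have "(\<Sum>z\<in>G. ?e z *s z) = 0"
      using G(4) sum_extend[OF G(1,2), of c "\<lambda>z. z"] by (simp add: scale_left_diff_distrib sum_subtractf)
    then have "p ^ n x dvd ?e x" using picket_decompD(4)[OF P G(1,3), of ?e x] G(2) x by blast
    moreover have xY: "x \<in> ?Y" using x F(2) by blast
    ultimately have "p dvd c x - d x * p"
      using x ab(1) dvd_trans[OF dvd_power[of a p]] by auto
    then have "p dvd (c x - d x * p) + d x * p" by (intro dvd_add) auto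
    then show "p dvd c x" by simp
  qed
qed

text \<open>Argue termwise. If a generator exceeds one of the bounds, its coordinate is divisible by
  \<open>p\<close>; if it stays strictly below one, it lies in a smaller bounded part. Only type (a,
  b) attains both.\<close>

lemma bounded_part_span:
  assumes P: "picket_decomp scale p U X n k" and U: "subspace U" and ab: "1 \<le> a" "b \<le> a"
  shows "bounded_part U a (a - b) \<subseteq> span ({x\<in>X. n x = a \<and> k x = b} \<union> bounded_part_radical U a (a - b))"
proof
  let ?l = "a - b" and ?Y = "{x\<in>X. n x = a \<and> k x = b}"
  let ?B = "bounded_part_radical U a ?l"
  fix y assume y: "y \<in> bounded_part U a ?l"
  obtain F r where F: "finite F" "F \<subseteq> X" "y = (\<Sum>x\<in>F. r x *s x)"
    using picket_decompD(3)[OF P] by blast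
  have pB: "p *s v \<in> ?B" for v
    unfolding bounded_part_radical_def by (intro span_base) auto
  have subB: "subspace ?B" unfolding bounded_part_radical_def by simp
  have mem: "x \<in> bounded_part U c d" if "x \<in> X" "n x \<le> c" "n x - k x \<le> d" for x c d
    using that picket_decompD(2)[OF P that(1), of "p ^ c"]
      picket_decomp_sum_mem_iff[OF P U, of "{x}" "\<lambda>_. p ^ d"]
    unfolding bounded_part_def by (simp add: le_imp_power_dvd)
  have "r x *s x \<in> span (?Y \<union> ?B)" if x: "x \<in> F" for x
  proof (cases "x \<in> ?Y")
    case True
    then show ?thesis by (intro span_scale span_base) blast
  next
    case nY: False
    have xX: "x \<in> X" using x F(2) by blast
    have kn: "k x \<le> n x" using picket_decompD(1)[OF P xX] by blast
    note d = bounded_part_coords[OF P U F(1,2) y[unfolded F(3)] x]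
    have "r x *s x \<in> ?B"
    proof (cases "a < n x \<or> ?l < n x - k x")
      case True
      then have "p dvd r x" using d pow_dvd_imp_dvd by blast
      then show ?thesis using dvd_scale_mem[OF subB pB] by blast
    next
      case False
      then have le: "n x \<le> a" "n x - k x \<le> ?l" by auto
      have "x \<in> ?B"
      proof (cases "n x = a")
        case True
        \<comment> \<open>As \<open>k x\<close> and \<open>b\<close> are both at most a, the
          truncated differences determine them, so equality would give type (a, b).\<close>
        then have "n x - k x < ?l" using nY xX le(2) kn ab(2) by auto
        then have "x \<in> bounded_part U a (?l - 1)" "?l \<noteq> 0" using mem[OF xX le(1)] by auto
        then show ?thesis unfolding bounded_part_radical_def by (intro span_base) auto
      next
        case False
        then have "x \<in> bounded_part U (a - 1) ?l" using mem[OF xX _ le(2)] le(1) by auto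
        then show ?thesis unfolding bounded_part_radical_def by (intro span_base) auto
      qed
      then show ?thesis by (rule subspace_scale[OF subB])
    qed
    then show ?thesis by (intro span_base) blast
  qed
  then show "y \<in> span (?Y \<union> ?B)" unfolding F(3) by (rule span_sum)
qed

lemma pickets_subset_bounded_part:
  assumes P: "picket_decomp scale p U X n k" and U: "subspace U"
  shows "{x\<in>X. n x = a \<and> k x = b} \<subseteq> bounded_part U a (a - b)"
proof
  fix x assume x: "x \<in> {x\<in>X. n x = a \<and> k x = b}"
  then show "x \<in> bounded_part U a (a - b)"
    using picket_decompD(2)[OF P, of x "p ^ a"]
      picket_decomp_sum_mem_iff[OF P U, of "{x}" "\<lambda>_. p ^ (a - b)"]
    unfolding bounded_part_def by simp
qed

text \<open>For each type the generators from both decompositions are bases modulo the same radical,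
  which depends only on \<open>U\<close> and the type. The bijections obtained are glued over all
  types.\<close>

lemma picket_decomp_unique:
  assumes U: "subspace U" and P: "picket_decomp scale p U X n k" and P': "picket_decomp scale p U Y n' k'"
  shows "\<exists>\<sigma>. bij_betw \<sigma> X Y \<and> (\<forall>x\<in>X. n' (\<sigma> x) = n x \<and> k' (\<sigma> x) = k x)"
proof -
  let ?X = "\<lambda>a b. {x\<in>X. n x = a \<and> k x = b}" and ?Y = "\<lambda>a b. {x\<in>Y. n' x = a \<and> k' x = b}"
  have ex: "\<exists>f. bij_betw f (?X a b) (?Y a b)" for a b
  proof (cases "1 \<le> a \<and> b \<le> a")
    case True
    then have ab: "1 \<le> a" "b \<le> a" by auto
    have pB: "p *s v \<in> bounded_part_radical U a (a - b)" for v
      unfolding bounded_part_radical_def by (intro span_base) auto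
    show ?thesis
    proof (rule p_bases_equipollent)
      show "subspace (bounded_part_radical U a (a - b))" unfolding bounded_part_radical_def by simp
      show "?X a b \<subseteq> span (?Y a b \<union> bounded_part_radical U a (a - b))"
        by (rule subset_trans[OF pickets_subset_bounded_part[OF P U] bounded_part_span[OF P' U ab]])
      show "?Y a b \<subseteq> span (?X a b \<union> bounded_part_radical U a (a - b))"
        by (rule subset_trans[OF pickets_subset_bounded_part[OF P' U] bounded_part_span[OF P U ab]])
    qed (use pickets_p_indep[OF P U ab] pickets_p_indep[OF P' U ab] pB in auto)
  next
    case False
    \<comment> \<open>No picket has a type outside 1 \<le> a, b \<le> a, so both sets are empty and
      the identity serves.\<close>
    then have "?X a b = {}" "?Y a b = {}"
      using picket_decompD(1)[OF P] picket_decompD(1)[OF P'] by auto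
    then have "bij_betw id (?X a b) (?Y a b)" by (simp only: bij_betw_id)
    then show ?thesis by (intro exI[of _ id])
  qed
  define f where "f a b = (SOME f. bij_betw f (?X a b) (?Y a b))" for a b
  have f: "bij_betw (f a b) (?X a b) (?Y a b)" for a b
    unfolding f_def by (rule someI_ex[OF ex])
  define \<sigma> where "\<sigma> x = f (n x) (k x) x" for x
  have \<sigma>: "\<sigma> x \<in> ?Y (n x) (k x)" if "x \<in> X" for x
    unfolding \<sigma>_def using bij_betw_apply[OF f, of x "n x" "k x"] that by simp
  have "bij_betw \<sigma> X Y"
  proof (rule bij_betwI')
    fix x x' assume x: "x \<in> X" "x' \<in> X"
    show "\<sigma> x = \<sigma> x' \<longleftrightarrow> x = x'"
    proof
      assume eq: "\<sigma> x = \<sigma> x'"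
      then have "n x = n x'" "k x = k x'" using \<sigma>[OF x(1)] \<sigma>[OF x(2)] by auto
      then show "x = x'"
        using eq x inj_onD[OF bij_betw_imp_inj_on[OF f[of "n x" "k x"]], of x x'] unfolding \<sigma>_def by auto
    qed simp
  next
    show "\<sigma> x \<in> Y" if "x \<in> X" for x using \<sigma>[OF that] by simp
  next
    fix y assume y: "y \<in> Y"
    have "y \<in> f (n' y) (k' y) ` ?X (n' y) (k' y)"
      using y bij_betw_imp_surj_on[OF f[of "n' y" "k' y"]] by simp
    then obtain x where x: "x \<in> ?X (n' y) (k' y)" "y = f (n' y) (k' y) x" by blast
    then have "y = \<sigma> x" unfolding \<sigma>_def by simp
    then show "\<exists>x\<in>X. y = \<sigma> x" using x(1) by blast
  qed
  then show ?thesis using \<sigma> by blast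
qed

end

theorem mainTheorem7:
  fixes p :: "'r::idom" and scale :: "'r \<Rightarrow> 'm::ab_group_add \<Rightarrow> 'm"
  assumes "dvr_with_uniformizer p" and "module scale"
  shows
   "(\<forall>U. module.subspace scale U \<and> sigma_cyc scale p \<and> (\<forall>m. scale p m \<in> U) \<longrightarrow>
        (\<exists>X n k. picket_decomp scale p U X n k \<and> (\<forall>x\<in>X. k x = n x \<or> k x = n x - 1)))
    \<and> (\<forall>U. module.subspace scale U \<and> sigma_cyc scale p \<and> (\<forall>u\<in>U. scale p u = 0) \<longrightarrow>
        ((\<exists>X n k. picket_decomp scale p U X n k \<and> (\<forall>x\<in>X. k x = 0 \<or> k x = 1))
          \<longleftrightarrow> sigma_cyc_quot scale p U))
    \<and> (\<forall>U X n k Y n' k'.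
        module.subspace scale U \<and> sigma_cyc scale p \<and>
        ((\<forall>m. scale p m \<in> U) \<or> (\<forall>u\<in>U. scale p u = 0)) \<and>
        picket_decomp scale p U X n k \<and> picket_decomp scale p U Y n' k' \<longrightarrow>
        (\<exists>\<sigma>. bij_betw \<sigma> X Y \<and> (\<forall>x\<in>X. n' (\<sigma> x) = n x \<and> k' (\<sigma> x) = k x)))"
proof -
  interpret dvr_module scale p
    using assms by (simp add: dvr_module_def dvr_module_axioms_def)
  show ?thesis
  proof (intro conjI allI impI, goal_cases)
    case (1 U)
    then show ?case by (intro picket_decomp_containing_pM) auto
  next
    case (2 U)
    then have U: "subspace U" "sigma_cyc scale p" "\<And>u. u \<in> U \<Longrightarrow> scale p u = 0" by auto
    show ?case
    proof
      assume "\<exists>X n k. picket_decomp scale p U X n k \<and> (\<forall>x\<in>X. k x = 0 \<or> k x = 1)"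
      then obtain X n k where "picket_decomp scale p U X n k" by (elim exE conjE)
      then show "sigma_cyc_quot scale p U" using U(1) by (rule sigma_cyc_quot_of_picket_decomp)
    next
      assume "sigma_cyc_quot scale p U"
      then show "\<exists>X n k. picket_decomp scale p U X n k \<and> (\<forall>x\<in>X. k x = 0 \<or> k x = 1)"
        using picket_decomp_socle_submodule[OF U(1,2)] U(3) by blast
    qed
  next
    case (3 U X n k Y n' k')
    then show ?case by (elim conjE) (rule picket_decomp_unique)
  qed
qed

end
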